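(* Consider the hyper-distance $\tilde\delta$ on $\mathrm{GL}_2(\mathbb{Z})\backslash \mathrm{M}_2^{\mathrm{ns}}(\mathbb{Z})$ given by $$\tilde\delta(a,b)=\det(a')\det(b'),$$ where $x=a\wedge b$ and $a=a'x$, $b=b'x$. Then: (1) $\log\tilde\delta(a,b)$ is the weighted distance between $a$ and $b$ in the graph $\mathrm{GL}_2(\mathbb{Z})\backslash \mathrm{M}_2^{\mathrm{ns}}(\mathbb{Z})$, where an edge $x\to y$ with $\det(y)=p\det(x)$ ($p$ prime) has weight $\log(p)$; (2) $\tilde\delta(x,y)=\delta(x,y)$ for $x,y\in\mathfrak{P}$; (3) the poset structure on $\mathfrak{P}$ as a subset of $\mathrm{GL}_2(\mathbb{Z})\backslash \mathrm{M}_2^{\mathrm{ns}}(\mathbb{Z})$ agrees with the one given by $X\le Y$ iff $\delta(1,Y)=\delta(X,Y)\,\delta(1,X)$; (4) $\mathfrak{P}$ is a fundamental domain for the monoid action of $\mathbb{N}_+^\times$ on $\mathrm{GL}_2(\mathbb{Z})\backslash \mathrm{M}_2^{\mathrm{ns}}(\mathbb{Z})$ by scalar multiplication.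
   Context: $\mathrm{M}_2^{\mathrm{ns}}(\mathbb{Z})$ is the monoid of $2\times2$ integer matrices with nonzero determinant. The quotient $\mathrm{GL}_2(\mathbb{Z})\backslash \mathrm{M}_2^{\mathrm{ns}}(\mathbb{Z})$ is partially ordered by $a\le b$ iff $b=ma$ for some $m\in \mathrm{M}_2^{\mathrm{ns}}(\mathbb{Z})$; $\wedge$ denotes the meet (greatest lower bound) in this poset. Determinants of elements of the quotient, and $\det(a'),\det(b')$, are taken up to sign, i.e. as positive integers. It is a graph: there is an edge $x\to y$ whenever $x\le y$ and $\det(y)=p\det(x)$ for a prime $p$; the weighted distance is the minimal total weight of an undirected path. Conway's big picture $\mathfrak{P}$ has vertex set $\mathbb{Q}_+\times\mathbb{Q}/\mathbb{Z}$ (with $\mathbb{Q}_+$ the positive rationals). For $X=(M,\frac gh)$ put $\alpha_X=\begin{pmatrix}M&\frac gh\\0&1\end{pmatrix}\in\mathrm{SL}_2(\mathbb{Z})\backslash\mathrm{GL}_2^+(\mathbb{Q})$, where $\mathrm{GL}_2^+(\mathbb{Q})$ is the group of rational matrices of positive determinant. The hyper-distance $\delta$ is $\delta(X,Y)=\det(\alpha_{XY}\,\alpha_X\alpha_Y^{-1})$, with $\alpha_{XY}$ the smallest positive rational number such that $\alpha_{XY}\alpha_X\alpha_Y^{-1}$ is an integer matrix (of positive determinant). There is an edge between $X$ and $Y$ iff $\delta(X,Y)$ is prime. The vertex denoted $1$ is $(1,0)$. $\mathfrak{P}$ is identified with a subset of $\mathrm{GL}_2(\mathbb{Z})\backslash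 \mathrm{M}_2^{\mathrm{ns}}(\mathbb{Z})$ via $X=(M,\frac gh)\mapsto\beta_X=\begin{pmatrix}MN&\frac ghN\\0&N\end{pmatrix}$, where $0\le\frac gh<1$ and $N$ is the minimal positive integer such that $\beta_X$ has integer entries. Its image is the set of classes of matrices whose four entries have greatest common divisor $1$. $\mathbb{N}_+^\times$ is the monoid of positive integers under multiplication; $\mathfrak P$ being a fundamental domain means that every element of $\mathrm{GL}_2(\mathbb{Z})\backslash \mathrm{M}_2^{\mathrm{ns}}(\mathbb{Z})$ is uniquely of the form $n\cdot x$ with $n\in\mathbb{N}_+$, $x\in\mathfrak{P}$. *)

theory Defs
  imports
    "HOL-Analysis.Analysis"
    "HOL-Computational_Algebra.Primes"
    "Graph_Theory.Weighted_Graph"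
begin

lemma mat2_eqI:
  fixes A B :: "'a^2^2"
  assumes "A $ 1 $ 1 = B $ 1 $ 1" "A $ 1 $ 2 = B $ 1 $ 2" "A $ 2 $ 1 = B $ 2 $ 1" "A $ 2 $ 2 = B $ 2 $ 2"
  shows "A = B"
  using assms by (simp add: vec_eq_iff forall_2)

lemma mat2_mult_nth:
  fixes A B :: "'a::semiring_1^2^2"
  shows "(A ** B) $ i $ j = A $ i $ 1 * B $ 1 $ j + A $ i $ 2 * B $ 2 $ j"
  by (simp add: matrix_matrix_mult_def sum_2)

definition adj2 :: "int^2^2 \<Rightarrow> int^2^2" where
  "adj2 A = vector [vector [A $ 2 $ 2, - A $ 1 $ 2], vector [- A $ 2 $ 1, A $ 1 $ 1]]"

lemma adj2_mult: "A ** adj2 A = mat (det A)" "adj2 A ** A = mat (det A)"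
  by (rule mat2_eqI; simp add: mat2_mult_nth adj2_def det_2 mat_def algebra_simps)+

lemma mat2_right_cancel:
  fixes P Q A :: "int^2^2"
  assumes "det A \<noteq> 0" "P ** A = Q ** A"
  shows "P = Q"
proof -
  have "P ** (A ** adj2 A) = Q ** (A ** adj2 A)"
    using assms(2) by (simp add: matrix_mul_assoc)
  then have "(P ** mat (det A)) $ i $ j = (Q ** mat (det A)) $ i $ j" for i j
    by (simp add: adj2_mult)
  from this[of 1 1] this[of 1 2] this[of 2 1] this[of 2 2] show ?thesis
    using assms(1) by (intro mat2_eqI) (simp_all add: mat2_mult_nth mat_def)
qed

lemma invertible_det_int:
  fixes U :: "int^2^2"
  assumes "invertible U"
  shows "\<bar>det U\<bar> = 1"
proof -
  obtain V where "U ** V = mat 1" using assms by (auto simp: invertible_def)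
  then have "det U * det V = 1" by (metis det_mul det_I)
  then show ?thesis using zmult_eq_1_iff by auto
qed

text \<open>Over \<open>int\<close>, \<^const>\<open>invertible\<close> is membership in \<open>GL\<^sub>2(\<int>)\<close>, i.e. the inverse is integral as well.\<close>

definition gl2_equiv :: "int^2^2 \<Rightarrow> int^2^2 \<Rightarrow> bool" where
  "gl2_equiv A B \<longleftrightarrow> det A \<noteq> 0 \<and> det B \<noteq> 0 \<and> (\<exists>U. invertible U \<and> B = U ** A)"

lemma gl2_equiv_refl: "gl2_equiv A A \<longleftrightarrow> det A \<noteq> 0"
proof -
  have "invertible (mat 1 :: int^2^2)"
    unfolding invertible_def by (intro exI[of _ "mat 1"]) simp
  then show ?thesis
    unfolding gl2_equiv_def by (metis matrix_mul_lid)
qed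

lemma gl2_equiv_sym: "gl2_equiv A B \<Longrightarrow> gl2_equiv B A"
  unfolding gl2_equiv_def invertible_def by (metis matrix_mul_assoc matrix_mul_lid)

lemma gl2_equiv_trans: "gl2_equiv A B \<Longrightarrow> gl2_equiv B C \<Longrightarrow> gl2_equiv A C"
  unfolding gl2_equiv_def by (metis invertible_mult matrix_mul_assoc)

quotient_type ns_class = "int^2^2" / partial: gl2_equiv
proof (rule part_equivpI)
  show "\<exists>A. gl2_equiv A A"
    by (rule exI[of _ "mat 1"]) (simp add: gl2_equiv_refl)
  show "symp gl2_equiv" by (rule sympI) (rule gl2_equiv_sym)
  show "transp gl2_equiv" by (rule transpI) (rule gl2_equiv_trans)
qed

text \<open>The determinant of a class, up to sign.\<close>

lift_definition cdet :: "ns_class \<Rightarrow> nat" is "\<lambda>A. nat \<bar>det A\<bar>"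
  by (auto simp: gl2_equiv_def det_mul abs_mult dest!: invertible_det_int)

definition mat2_le :: "int^2^2 \<Rightarrow> int^2^2 \<Rightarrow> bool" where
  "mat2_le A B \<longleftrightarrow> (\<exists>M. det M \<noteq> 0 \<and> B = M ** A)"

lemma mat2_le_trans: "mat2_le A B \<Longrightarrow> mat2_le B C \<Longrightarrow> mat2_le A C"
  unfolding mat2_le_def by (metis matrix_mul_assoc det_mul mult_eq_0_iff)

lemma gl2_equiv_imp_mat2_le: "gl2_equiv A B \<Longrightarrow> mat2_le A B"
  unfolding gl2_equiv_def mat2_le_def by (metis invertible_det_int abs_0 zero_neq_one)

lemma mat2_le_antisym:
  assumes "det A \<noteq> 0" "mat2_le A B" "mat2_le B A"
  shows "gl2_equiv A B"
proof -
  obtain M N where M: "det M \<noteq> 0" "B = M ** A" and N: "det N \<noteq> 0" "A = N ** B"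
    using assms by (auto simp: mat2_le_def)
  have dB: "det B \<noteq> 0" using M assms(1) by (simp add: det_mul)
  have "(N ** M) ** A = mat 1 ** A" using M N by (metis matrix_mul_assoc matrix_mul_lid)
  then have "N ** M = mat 1" using mat2_right_cancel assms(1) by blast
  moreover have "(M ** N) ** B = mat 1 ** B" using M N by (metis matrix_mul_assoc matrix_mul_lid)
  then have "M ** N = mat 1" using mat2_right_cancel dB by blast
  ultimately show ?thesis using assms(1) dB M(2) by (auto simp: gl2_equiv_def invertible_def)
qed

text \<open>The lattice spanned by the rows of \<open>A\<close> and \<open>B\<close> has a basis in Hermite form: a greatest common right divisor.\<close>

lemma mat2_gcrd:
  fixes A B :: "int^2^2"
  assumes dA: "det A \<noteq> 0" and dB: "det B \<noteq> 0"
  shows "\<exists>X U V. det X \<noteq> 0 \<and> X = U ** A + V ** B \<and> mat2_le X A \<and> mat2_le X B"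
proof -
  define L where "L = {r :: int^2. \<exists>u v. r = u v* A + v v* B}"
  have add: "r + s \<in> L" if rs: "r \<in> L" "s \<in> L" for r s
  proof -
    obtain u v u' v' where "r = u v* A + v v* B" "s = u' v* A + v' v* B"
      using rs by (auto simp: L_def)
    then have "r + s = (u + u') v* A + (v + v') v* B"
      by (simp add: vec_eq_iff vector_matrix_mult_def sum_2 algebra_simps)
    then show ?thesis by (auto simp: L_def)
  qed
  have sc: "k *s r \<in> L" if r: "r \<in> L" for r k
  proof -
    obtain u v where "r = u v* A + v v* B"
      using r by (auto simp: L_def)
    then have "k *s r = (k *s u) v* A + (k *s v) v* B"
      by (simp add: vec_eq_iff vector_matrix_mult_def sum_2 algebra_simps)
    then show ?thesis by (auto simp: L_def)
  qed
  have inA: "u v* A \<in> L" for u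
  proof -
    have "u v* A = u v* A + 0 v* B" by simp
    then show ?thesis unfolding L_def by blast
  qed
  have inB: "v v* B \<in> L" for v
  proof -
    have "v v* B = 0 v* A + v v* B" by simp
    then show ?thesis unfolding L_def by blast
  qed
  let ?d = "det A"
  have dL: "vector [?d * x, ?d * y] \<in> L" for x y
  proof -
    have "vector [?d * x, ?d * y] = (vector [x, y] v* adj2 A) v* A"
      by (simp add: adj2_def det_2 vec_eq_iff forall_2 vector_matrix_mult_def sum_2 algebra_simps)
    then show ?thesis using inA by metis
  qed
  define P where "P n \<longleftrightarrow> 0 < n \<and> (\<exists>r\<in>L. r $ 1 = int n)" for n :: nat
  define Q where "Q n \<longleftrightarrow> 0 < n \<and> (\<exists>r\<in>L. r $ 1 = 0 \<and> r $ 2 = int n)" for n :: nat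
  have sg: "?d * sgn ?d = \<bar>?d\<bar>" by (simp add: abs_sgn)
  have "P (nat \<bar>?d\<bar>)"
    unfolding P_def using dA dL[of "sgn ?d" 0]
    by (intro conjI bexI[of _ "vector [?d * sgn ?d, ?d * 0]"]) (simp_all add: sg)
  then have P: "P (LEAST n. P n)" by (rule LeastI)
  have "Q (nat \<bar>?d\<bar>)"
    unfolding Q_def using dA dL[of 0 "sgn ?d"]
    by (intro conjI bexI[of _ "vector [?d * 0, ?d * sgn ?d]"]) (simp_all add: sg)
  then have Q: "Q (LEAST n. Q n)" by (rule LeastI)
  define p where "p = (LEAST n. P n)"
  define q where "q = (LEAST n. Q n)"
  obtain e where e: "e \<in> L" "e $ 1 = int p" and p0: "0 < p"
    using P by (auto simp: P_def p_def)
  obtain f where f: "f \<in> L" "f $ 1 = 0" "f $ 2 = int q" and q0: "0 < q"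
    using Q by (auto simp: Q_def q_def)
  have gen: "\<exists>k l. r = k *s e + l *s f" if r: "r \<in> L" for r
  proof -
    define k where "k = r $ 1 div int p"
    define s where "s = r + (- k) *s e"
    have sL: "s \<in> L" unfolding s_def using add sc r e(1) by blast
    have s1: "s $ 1 = r $ 1 mod int p"
      by (simp add: s_def k_def e(2) minus_div_mult_eq_mod[symmetric])
    have "s $ 1 = 0"
    proof (rule ccontr)
      assume ne: "s $ 1 \<noteq> 0"
      have "0 \<le> s $ 1" "s $ 1 < int p" using s1 p0 by simp_all
      then have "P (nat (s $ 1))" "nat (s $ 1) < p" using ne sL by (auto simp: P_def)
      then show False unfolding p_def using not_less_Least by blast
    qed
    define l where "l = s $ 2 div int q"
    define t where "t = s + (- l) *s f"
    have tL: "t \<in> L" unfolding t_def using add sc sL f(1) by blast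
    have t1: "t $ 1 = 0" by (simp add: t_def \<open>s $ 1 = 0\<close> f(2))
    have t2: "t $ 2 = s $ 2 mod int q"
      by (simp add: t_def l_def f(3) minus_div_mult_eq_mod[symmetric])
    have "t $ 2 = 0"
    proof (rule ccontr)
      assume ne: "t $ 2 \<noteq> 0"
      have "0 \<le> t $ 2" "t $ 2 < int q" using t2 q0 by simp_all
      then have "Q (nat (t $ 2))" "nat (t $ 2) < q" using ne tL t1 by (auto simp: Q_def)
      then show False unfolding q_def using not_less_Least by blast
    qed
    have "t = 0" using t1 \<open>t $ 2 = 0\<close> by (simp add: vec_eq_iff forall_2)
    then have "r = k *s e + l *s f"
      by (simp add: t_def s_def vec_eq_iff algebra_simps add_eq_0_iff2)
    then show ?thesis by blast
  qed
  define X :: "int^2^2" where "X = vector [e, f]"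
  have dX: "det X \<noteq> 0" using p0 q0 by (simp add: X_def det_2 e f)
  obtain u1 v1 where e': "e = u1 v* A + v1 v* B" using e(1) by (auto simp: L_def)
  obtain u2 v2 where f': "f = u2 v* A + v2 v* B" using f(1) by (auto simp: L_def)
  have "X = vector [u1, u2] ** A + vector [v1, v2] ** B"
    by (rule mat2_eqI; simp add: X_def e' f' mat2_mult_nth vector_matrix_mult_def sum_2 algebra_simps)
  moreover have "mat2_le X C" if dC: "det C \<noteq> 0" and rows: "\<And>i. C $ i \<in> L" for C
  proof -
    obtain k1 l1 where 1: "C $ 1 = k1 *s e + l1 *s f" using gen rows by blast
    obtain k2 l2 where 2: "C $ 2 = k2 *s e + l2 *s f" using gen rows by blast
    let ?M = "vector [vector [k1, l1], vector [k2, l2]] :: int^2^2"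
    have "C = ?M ** X"
      by (rule mat2_eqI; simp add: 1 2 X_def mat2_mult_nth)
    moreover from this have "det ?M \<noteq> 0" using dC by (metis det_mul mult_zero_left)
    ultimately show ?thesis unfolding mat2_le_def by blast
  qed
  moreover have row: "axis i 1 v* C = C $ i" for i and C :: "int^2^2"
    using exhaust_2[of i] by (auto simp: vec_eq_iff vector_matrix_mult_def sum_2 axis_def)
  have "A $ i \<in> L" "B $ i \<in> L" for i
    using inA[of "axis i 1"] inB[of "axis i 1"] by (simp_all add: row)
  ultimately show ?thesis using dX dA dB by blast
qed

instantiation ns_class :: semilattice_inf
begin

lift_definition less_eq_ns_class :: "ns_class \<Rightarrow> ns_class \<Rightarrow> bool" is mat2_le
  by (meson gl2_equiv_imp_mat2_le gl2_equiv_sym mat2_le_trans)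

definition less_ns_class :: "ns_class \<Rightarrow> ns_class \<Rightarrow> bool" where
  "less_ns_class a b \<longleftrightarrow> a \<le> b \<and> \<not> b \<le> a"

definition inf_ns_class :: "ns_class \<Rightarrow> ns_class \<Rightarrow> ns_class" where
  "inf_ns_class a b = (THE x. x \<le> a \<and> x \<le> b \<and> (\<forall>z. z \<le> a \<and> z \<le> b \<longrightarrow> z \<le> x))"

instance
proof -
  have refl: "a \<le> a" for a :: ns_class
    by transfer (auto simp: gl2_equiv_refl intro: gl2_equiv_imp_mat2_le)
  have trans: "a \<le> b \<Longrightarrow> b \<le> c \<Longrightarrow> a \<le> c" for a b c :: ns_class
    by transfer (rule mat2_le_trans)
  have antisym: "a \<le> b \<Longrightarrow> b \<le> a \<Longrightarrow> a = b" for a b :: ns_class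
    by transfer (simp add: gl2_equiv_refl mat2_le_antisym)
  have ex: "\<exists>x. x \<le> a \<and> x \<le> b \<and> (\<forall>z. z \<le> a \<and> z \<le> b \<longrightarrow> z \<le> x)" for a b :: ns_class
  proof transfer
    fix A B :: "int^2^2" assume "gl2_equiv A A" "gl2_equiv B B"
    then have d: "det A \<noteq> 0" "det B \<noteq> 0" by (simp_all add: gl2_equiv_refl)
    obtain X U V where X: "det X \<noteq> 0" "X = U ** A + V ** B" "mat2_le X A" "mat2_le X B"
      using mat2_gcrd[OF d] by blast
    have "mat2_le Z X" if Z: "mat2_le Z A" "mat2_le Z B" for Z
    proof -
      obtain M N where "A = M ** Z" "B = N ** Z" using Z by (auto simp: mat2_le_def)
      then have *: "X = (U ** M + V ** N) ** Z"
        using X(2) by (intro mat2_eqI) (simp_all add: mat2_mult_nth algebra_simps)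
      then have "det (U ** M + V ** N) \<noteq> 0" using X(1) by (metis det_mul mult_zero_left)
      with * show ?thesis unfolding mat2_le_def by blast
    qed
    with X show "\<exists>x\<in>{x. gl2_equiv x x}. mat2_le x A \<and> mat2_le x B \<and>
        (\<forall>z\<in>{x. gl2_equiv x x}. mat2_le z A \<and> mat2_le z B \<longrightarrow> mat2_le z x)"
      by (auto simp: gl2_equiv_refl Bex_def)
  qed
  have inf: "inf a b \<le> a \<and> inf a b \<le> b \<and> (\<forall>z. z \<le> a \<and> z \<le> b \<longrightarrow> z \<le> inf a b)" for a b :: ns_class
    unfolding inf_ns_class_def
  proof (rule theI')
    show "\<exists>!x. x \<le> a \<and> x \<le> b \<and> (\<forall>z. z \<le> a \<and> z \<le> b \<longrightarrow> z \<le> x)"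
      using ex[of a b] antisym by blast
  qed
  show "OFCLASS(ns_class, semilattice_inf_class)"
    by standard (use refl trans antisym inf in \<open>auto simp: less_ns_class_def\<close>)
qed

end

lemma abs_ns_class_cases:
  obtains A where "det A \<noteq> 0" "a = abs_ns_class A"
proof -
  have "gl2_equiv (rep_ns_class a) (rep_ns_class a)"
    using Quotient_ns_class by (rule Quotient_rep_reflp)
  moreover have "a = abs_ns_class (rep_ns_class a)"
    using Quotient_ns_class by (metis Quotient_abs_rep)
  ultimately show thesis using that by (auto simp: gl2_equiv_refl)
qed

lemma cdet_abs: "det A \<noteq> 0 \<Longrightarrow> cdet (abs_ns_class A) = nat \<bar>det A\<bar>"
  by (simp add: cdet.abs_eq gl2_equiv_refl)

lemma less_eq_abs:
  "det A \<noteq> 0 \<Longrightarrow> det B \<noteq> 0 \<Longrightarrow> abs_ns_class A \<le> abs_ns_class B \<longleftrightarrow> mat2_le A B"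
  by (simp add: less_eq_ns_class.abs_eq gl2_equiv_refl)

text \<open>
  The factors \<open>A'\<close> and \<open>B'\<close> depend on the chosen representatives, the product of their absolute determinants
  does not: see \<open>ext_hyper_dist_ex1\<close> below.
\<close>

definition ext_hyper_dist :: "ns_class \<Rightarrow> ns_class \<Rightarrow> nat" where
  "ext_hyper_dist a b = (THE d. \<exists>A' B' X. det A' \<noteq> 0 \<and> det B' \<noteq> 0 \<and> det X \<noteq> 0 \<and>
     inf a b = abs_ns_class X \<and> a = abs_ns_class (A' ** X) \<and> b = abs_ns_class (B' ** X) \<and>
     d = nat \<bar>det A'\<bar> * nat \<bar>det B'\<bar>)"

lemma ext_hyper_dist_ex1:
  "\<exists>!d. \<exists>A' B' X. det A' \<noteq> 0 \<and> det B' \<noteq> 0 \<and> det X \<noteq> 0 \<and>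
     inf a b = abs_ns_class X \<and> a = abs_ns_class (A' ** X) \<and> b = abs_ns_class (B' ** X) \<and>
     d = nat \<bar>det A'\<bar> * nat \<bar>det B'\<bar>" (is "\<exists>!d. ?P d")
proof (rule ex_ex1I)
  obtain A where A: "det A \<noteq> 0" "a = abs_ns_class A" by (rule abs_ns_class_cases)
  obtain B where B: "det B \<noteq> 0" "b = abs_ns_class B" by (rule abs_ns_class_cases)
  obtain X where X: "det X \<noteq> 0" "inf a b = abs_ns_class X" by (rule abs_ns_class_cases)
  have "abs_ns_class X \<le> abs_ns_class A" "abs_ns_class X \<le> abs_ns_class B"
    by (simp_all flip: A(2) B(2) X(2))
  then have "mat2_le X A" "mat2_le X B" using A(1) B(1) X(1) by (simp_all add: less_eq_abs)
  then obtain A' B' where "det A' \<noteq> 0" "A = A' ** X" "det B' \<noteq> 0" "B = B' ** X"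
    by (auto simp: mat2_le_def)
  then show "\<exists>d. ?P d" using A B X by blast
next
  fix d d' assume d: "?P d" and d': "?P d'"
  have fact: "e * cdet (inf a b) ^ 2 = cdet a * cdet b" "0 < cdet (inf a b)" if e: "?P e" for e
  proof -
    obtain A' B' X where *: "det A' \<noteq> 0" "det B' \<noteq> 0" "det X \<noteq> 0"
      "inf a b = abs_ns_class X" "a = abs_ns_class (A' ** X)" "b = abs_ns_class (B' ** X)"
      "e = nat \<bar>det A'\<bar> * nat \<bar>det B'\<bar>"
      using e by blast
    have "cdet (inf a b) = nat \<bar>det X\<bar>" using * by (simp add: cdet_abs)
    moreover have "cdet a = nat \<bar>det A'\<bar> * nat \<bar>det X\<bar>"
      using * by (simp add: cdet_abs det_mul abs_mult nat_mult_distrib)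
    moreover have "cdet b = nat \<bar>det B'\<bar> * nat \<bar>det X\<bar>"
      using * by (simp add: cdet_abs det_mul abs_mult nat_mult_distrib)
    ultimately show "e * cdet (inf a b) ^ 2 = cdet a * cdet b" "0 < cdet (inf a b)"
      using * by (simp_all add: power2_eq_square)
  qed
  show "d = d'" using fact[OF d] fact[OF d'] by (metis mult_cancel2 power_not_zero not_less0)
qed

text \<open>Only meaningful for \<open>0 < n\<close>, where it does not depend on the representative (\<open>class_scale_abs\<close>).\<close>

definition class_scale :: "nat \<Rightarrow> ns_class \<Rightarrow> ns_class" where
  "class_scale n a = abs_ns_class (map_matrix ((*) (int n)) (rep_ns_class a))"

lemma class_scale_abs:
  assumes "0 < n" "det A \<noteq> 0"
  shows "class_scale n (abs_ns_class A) = abs_ns_class (map_matrix ((*) (int n)) A)"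
proof -
  define R where "R = rep_ns_class (abs_ns_class A)"
  have m: "map_matrix ((*) (int n)) B = mat (int n) ** B" for B :: "int^2^2"
    by (rule mat2_eqI; simp add: mat2_mult_nth mat_def)
  have c: "U ** mat (int n) = mat (int n) ** U" for U :: "int^2^2"
    by (rule mat2_eqI; simp add: mat2_mult_nth mat_def)
  have "gl2_equiv R A"
    unfolding R_def using assms(2) by (intro Quotient_rep_abs[OF Quotient_ns_class]) (simp add: gl2_equiv_refl)
  then obtain U where U: "invertible U" "A = U ** R" "det R \<noteq> 0" by (auto simp: gl2_equiv_def)
  have "det (mat (int n) :: int^2^2) \<noteq> 0" using assms(1) by (simp add: det_2 mat_def)
  then have "gl2_equiv (mat (int n) ** R) (mat (int n) ** A)"
    using U assms unfolding gl2_equiv_def by (metis c det_mul matrix_mul_assoc mult_eq_0_iff)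
  then have "abs_ns_class (mat (int n) ** R) = abs_ns_class (mat (int n) ** A)"
    by (rule Quotient_rel_abs[OF Quotient_ns_class])
  then show ?thesis by (simp add: class_scale_def R_def m)
qed

definition ns_edge :: "ns_class \<Rightarrow> nat \<Rightarrow> ns_class \<Rightarrow> bool" where
  "ns_edge x p y \<longleftrightarrow> prime p \<and> x \<le> y \<and> cdet y = p * cdet x"

text \<open>
  Each edge gives two opposite arcs, so that directed walks are the undirected paths of the graph;
  an arc carries its prime as a label.
\<close>

definition ns_graph :: "(ns_class, ns_class \<times> nat \<times> ns_class) pre_digraph" where
  "ns_graph = \<lparr>verts = UNIV, arcs = {(x, p, y). ns_edge x p y \<or> ns_edge y p x},
     tail = (\<lambda>(x, p, y). x), head = (\<lambda>(x, p, y). y)\<rparr>"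

interpretation ns_graph: wf_digraph ns_graph
  by standard (auto simp: ns_graph_def)

definition ns_weight :: "(ns_class \<times> nat \<times> ns_class) weight_fun" where
  "ns_weight = (\<lambda>(x, p, y). ln (real p))"

definition is_weighted_dist :: "ns_class \<Rightarrow> ns_class \<Rightarrow> real \<Rightarrow> bool" where
  "is_weighted_dist a b d \<longleftrightarrow>
     (\<exists>w. ns_graph.awalk a w b \<and> ns_graph.awalk_cost ns_weight w = d) \<and>
     (\<forall>w. ns_graph.awalk a w b \<longrightarrow> d \<le> ns_graph.awalk_cost ns_weight w)"

text \<open>
  The type of vertices is \<open>\<rat>\<^sub>+ \<times> \<rat>/\<int>\<close>. The matrix \<open>alpha M q\<close> stands for its class in
  \<open>SL\<^sub>2(\<int>) \ GL\<^sub>2\<^sup>+(\<rat>)\<close>; by \<open>hyper_dist_mat_SL2\<close> the hyper-distance is a function of the classes.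
\<close>

definition picture_rel :: "rat \<times> rat \<Rightarrow> rat \<times> rat \<Rightarrow> bool" where
  "picture_rel X Y \<longleftrightarrow> 0 < fst X \<and> fst X = fst Y \<and> snd X - snd Y \<in> \<int>"

quotient_type picture = "rat \<times> rat" / partial: picture_rel
proof (rule part_equivpI)
  show "\<exists>X. picture_rel X X" by (rule exI[of _ "(1, 0)"]) (simp add: picture_rel_def)
  show "symp picture_rel"
    by (rule sympI) (metis picture_rel_def minus_diff_eq minus_in_Ints_iff)
  show "transp picture_rel"
  proof (rule transpI)
    fix X Y Z assume "picture_rel X Y" "picture_rel Y Z"
    then show "picture_rel X Z"
      using Ints_add[of "snd X - snd Y" "snd Y - snd Z"] by (auto simp: picture_rel_def)
  qed
qed

definition alpha :: "rat \<Rightarrow> rat \<Rightarrow> rat^2^2" where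
  "alpha M q = vector [vector [M, q], vector [0, 1]]"

definition integral_mat :: "rat^2^2 \<Rightarrow> bool" where
  "integral_mat A \<longleftrightarrow> (\<forall>i j. A $ i $ j \<in> \<int>)"

definition min_scaling :: "rat^2^2 \<Rightarrow> rat" where
  "min_scaling A = (LEAST s. 0 < s \<and> integral_mat (map_matrix ((*) s) A))"

definition hyper_dist_mat :: "rat^2^2 \<Rightarrow> rat^2^2 \<Rightarrow> rat" where
  "hyper_dist_mat A B =
     (let C = A ** matrix_inv B in det (map_matrix ((*) (min_scaling C)) C))"

lemma matrix_inv_unique_rat:
  fixes A B :: "rat^2^2"
  assumes "B ** A = mat 1"
  shows "matrix_inv A = B"
proof -
  have AB: "A ** B = mat 1" using assms by (rule matrix_left_right_inverse1)
  have "\<exists>A'. A ** A' = mat 1 \<and> A' ** A = mat 1" using assms AB by blast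
  then have "A ** matrix_inv A = mat 1 \<and> matrix_inv A ** A = mat 1"
    unfolding matrix_inv_def by (rule someI_ex)
  then have "B ** (A ** matrix_inv A) = B" by simp
  then show ?thesis by (simp add: matrix_mul_assoc assms)
qed

lemma integral_mat_mult: "integral_mat A \<Longrightarrow> integral_mat B \<Longrightarrow> integral_mat (A ** B)"
  by (auto simp: integral_mat_def mat2_mult_nth intro!: Ints_add Ints_mult)

lemma hyper_dist_mat_SL2:
  fixes A B U V :: "rat^2^2"
  assumes U: "integral_mat U" "det U = 1" and V: "integral_mat V" "det V = 1" and B: "det B \<noteq> 0"
  shows "hyper_dist_mat (U ** A) (V ** B) = hyper_dist_mat A B"
proof -
  have inv: "\<exists>W'. integral_mat W' \<and> det W' = 1 \<and> W' ** W = mat 1 \<and> W ** W' = mat 1"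
    if W: "integral_mat W" "det W = 1" for W
  proof -
    let ?W' = "vector [vector [W $ 2 $ 2, - W $ 1 $ 2], vector [- W $ 2 $ 1, W $ 1 $ 1]] :: rat^2^2"
    have d: "W $ 1 $ 1 * W $ 2 $ 2 - W $ 1 $ 2 * W $ 2 $ 1 = 1" using W(2) by (simp add: det_2)
    have "integral_mat ?W'" using W(1) by (simp add: integral_mat_def forall_2)
    moreover have "det ?W' = 1" using d by (simp add: det_2 algebra_simps)
    moreover have "?W' ** W = mat 1" "W ** ?W' = mat 1"
      by (rule mat2_eqI; use d in \<open>simp add: mat2_mult_nth mat_def algebra_simps\<close>)+
    ultimately show ?thesis by blast
  qed
  obtain U' where U': "integral_mat U'" "det U' = 1" "U' ** U = mat 1" using inv[OF U] by blast
  obtain V' where V': "integral_mat V'" "det V' = 1" "V' ** V = mat 1" using inv[OF V] by blast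
  have "invertible B" using B by (simp add: invertible_det_nz)
  then obtain B' where B': "B' ** B = mat 1" by (auto simp: invertible_def)
  have iB: "matrix_inv B = B'" by (rule matrix_inv_unique_rat[OF B'])
  have "(B' ** V') ** (V ** B) = mat 1"
    by (metis B' V'(3) matrix_mul_assoc matrix_mul_lid)
  then have iVB: "matrix_inv (V ** B) = B' ** V'" by (rule matrix_inv_unique_rat)
  define C where "C = A ** B'"
  define D where "D = U ** C ** V'"
  have D: "(U ** A) ** matrix_inv (V ** B) = D"
    by (simp add: D_def C_def iVB matrix_mul_assoc)
  have sm: "map_matrix ((*) s) (P ** Q ** R) = P ** map_matrix ((*) s) Q ** R" for s and P Q R :: "rat^2^2"
    by (rule mat2_eqI; simp add: mat2_mult_nth algebra_simps)
  have C: "C = U' ** D ** V"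
  proof -
    have "U' ** D ** V = (U' ** U) ** C ** (V' ** V)"
      by (simp add: D_def matrix_mul_assoc)
    then show ?thesis using U' V' by simp
  qed
  have "integral_mat (map_matrix ((*) s) D) \<longleftrightarrow> integral_mat (map_matrix ((*) s) C)" for s
    using integral_mat_mult U(1) V(1) U'(1) V'(1)
    by (metis C D_def sm)
  then have m: "min_scaling D = min_scaling C" by (simp add: min_scaling_def)
  have "det (map_matrix ((*) s) D) = det (map_matrix ((*) s) C)" for s
    by (simp add: D_def sm det_mul U V')
  then show ?thesis unfolding hyper_dist_mat_def Let_def D iB by (simp add: m C_def)
qed

lemma alpha_shift:
  assumes "q' - q \<in> \<int>"
  shows "\<exists>U. integral_mat U \<and> det U = 1 \<and> alpha M q' = U ** alpha M q"
proof (intro exI conjI)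
  let ?U = "vector [vector [1, q' - q], vector [0, 1]] :: rat^2^2"
  show "integral_mat ?U" using assms by (simp add: integral_mat_def forall_2)
  show "det ?U = 1" by (simp add: det_2)
  show "alpha M q' = ?U ** alpha M q"
    by (rule mat2_eqI; simp add: mat2_mult_nth alpha_def)
qed

lift_definition hyper_dist :: "picture \<Rightarrow> picture \<Rightarrow> rat" is
  "\<lambda>(M, q) (M', q'). hyper_dist_mat (alpha M q) (alpha M' q')"
proof -
  fix X X' Y Y' assume X: "picture_rel X X'" and Y: "picture_rel Y Y'"
  obtain M q q' where 1: "X = (M, q)" "X' = (M, q')" "q - q' \<in> \<int>"
    using X by (cases X; cases X') (auto simp: picture_rel_def)
  obtain K r r' where 2: "Y = (K, r)" "Y' = (K, r')" "r - r' \<in> \<int>" "0 < K"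
    using Y by (cases Y; cases Y') (auto simp: picture_rel_def)
  obtain U where U: "integral_mat U" "det U = 1" "alpha M q = U ** alpha M q'"
    using alpha_shift[OF 1(3)] by blast
  obtain V where V: "integral_mat V" "det V = 1" "alpha K r = V ** alpha K r'"
    using alpha_shift[OF 2(3)] by blast
  have "det (alpha K r') \<noteq> 0" using 2(4) by (simp add: det_2 alpha_def)
  then show "(case X of (M, q) \<Rightarrow> \<lambda>(M', q'). hyper_dist_mat (alpha M q) (alpha M' q')) Y =
      (case X' of (M, q) \<Rightarrow> \<lambda>(M', q'). hyper_dist_mat (alpha M q) (alpha M' q')) Y'"
    using hyper_dist_mat_SL2[OF U(1,2) V(1,2)] by (simp add: 1 2 U(3) V(3))
qed

lift_definition picture_one :: picture is "(1, 0)"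
  by (simp add: picture_rel_def)

definition denominator :: "rat^2^2 \<Rightarrow> nat" where
  "denominator A = (LEAST N. 0 < N \<and> integral_mat (map_matrix ((*) (of_nat N)) A))"

text \<open>The scaled matrix is integral, so the floor only converts its entries to integers.\<close>

definition beta_matrix :: "rat \<Rightarrow> rat \<Rightarrow> int^2^2" where
  "beta_matrix M q =
     map_matrix floor (map_matrix ((*) (of_nat (denominator (alpha M q)))) (alpha M q))"

lemma denominator_alpha:
  "0 < denominator (alpha M q) \<and>
   integral_mat (map_matrix ((*) (of_nat (denominator (alpha M q)))) (alpha M q))"
  unfolding denominator_def
proof (rule LeastI_ex)
  have den: "\<exists>n>0. of_nat n * x \<in> \<int>" for x :: rat
  proof -
    obtain a b where q: "quotient_of x = (a, b)" by (cases "quotient_of x")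
    have b: "0 < b" "x = of_int a / of_int b"
      using q by (auto dest: quotient_of_denom_pos quotient_of_div)
    then have "of_nat (nat b) * x = of_int a" by simp
    then show ?thesis using b(1) by (intro exI[of _ "nat b"]) simp
  qed
  obtain m where m: "0 < m" "of_nat m * M \<in> \<int>" using den[of M] by auto
  obtain n where n: "0 < n" "of_nat n * q \<in> \<int>" using den[of q] by auto
  have "of_nat (m * n) * M \<in> \<int>" "of_nat (m * n) * q \<in> \<int>"
    using Ints_mult[OF Ints_of_nat[of n] m(2)] Ints_mult[OF Ints_of_nat[of m] n(2)]
    by (simp_all add: mult_ac)
  then show "\<exists>N. 0 < N \<and> integral_mat (map_matrix ((*) (of_nat N)) (alpha M q))"
    using m(1) n(1) by (intro exI[of _ "m * n"]) (simp add: integral_mat_def forall_2 alpha_def)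
qed

lemma det_beta_matrix:
  assumes "0 < M"
  shows "det (beta_matrix M q) \<noteq> 0"
proof -
  define N where "N = denominator (alpha M q)"
  have N: "0 < N" "of_nat N * M \<in> \<int>"
    using denominator_alpha[of M q] by (auto simp: N_def integral_mat_def forall_2 alpha_def)
  then obtain k where k: "of_nat N * M = of_int k" by (auto elim: Ints_cases)
  have "0 < of_nat N * M" using N(1) assms by simp
  then have "k \<noteq> 0" using k by auto
  then show ?thesis
    using N(1) by (simp add: det_2 beta_matrix_def N_def[symmetric]) (simp add: alpha_def k)
qed

text \<open>\<^const>\<open>frac\<close> selects the representative in \<open>[0, 1)\<close>.\<close>

lift_definition beta :: "picture \<Rightarrow> ns_class" is "\<lambda>(M, q). beta_matrix M (frac q)"
proof -
  fix X Y assume XY: "picture_rel X Y"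
  obtain M q q' where 1: "X = (M, q)" "Y = (M, q')" "q - q' \<in> \<int>" "0 < M"
    using XY by (cases X; cases Y) (auto simp: picture_rel_def)
  have "(q - q') + of_int \<lfloor>q'\<rfloor> \<in> \<int>" using 1(3) by (intro Ints_add) simp_all
  then have "q - frac q' \<in> \<int>" by (simp add: frac_def algebra_simps)
  then have "frac q = frac q'" by (simp add: frac_unique_iff frac_lt_1)
  then show "gl2_equiv (case X of (M, q) \<Rightarrow> beta_matrix M (frac q))
      (case Y of (M, q) \<Rightarrow> beta_matrix M (frac q))"
    using 1(4) by (simp add: 1(1,2) gl2_equiv_refl det_beta_matrix)
qed

end

theory Submission
  imports Defs
begin

text \<open>
  A class is determined by its row lattice in \<open>\<int>\<^sup>2\<close>: the order is reverse inclusion, the meet is the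
  sum of lattices and the determinant is the index. If \<open>A\<close> and \<open>B\<close> represent \<open>a\<close> and \<open>b\<close>, the index of
  the sum is the greatest common divisor of the six \<open>2 \<times> 2\<close> minors of the matrix stacking \<open>A\<close> above
  \<open>B\<close>. Two of these minors are \<open>det A\<close> and \<open>det B\<close>, the other four are, up to sign, the entries of
  \<open>A adj(B)\<close>. This formula (\<open>cdet_inf\<close>) carries the whole proof, together with
  \<open>\<delta>(a, b) det(a \<and> b)\<^sup>2 = det a det b\<close> (\<open>ext_hyper_dist_mult\<close>) for the extended hyper-distance \<open>\<delta>\<close>.

  Weighted distance: each inclusion of lattices refines to a chain of inclusions of prime index
  (\<open>edge_below\<close>), so going from \<open>a\<close> down to \<open>a \<and> b\<close> and up to \<open>b\<close> costs \<open>ln \<delta>(a, b)\<close>. No walk is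
  cheaper, because replacing \<open>a\<close> by its neighbour along an edge of weight \<open>ln p\<close> changes \<open>\<delta>(a, b)\<close> at
  most by the factor \<open>p\<close> (\<open>ext_hyper_dist_edge\<close>); the point is that passing to a sublattice of index \<open>m\<close>
  increases the index of a sum at most by the factor \<open>m\<close> (\<open>cdet_inf_index\<close>), which follows from the
  formula since multiplying by the adjugate recovers \<open>m\<close> times each minor.

  Agreement with Conway's hyper-distance: up to a positive scalar, \<open>\<alpha>\<^sub>X \<alpha>\<^sub>Y\<inverse>\<close> is \<open>A adj(B)\<close> for
  \<open>A = \<beta>\<^sub>X\<close> and \<open>B = \<beta>\<^sub>Y\<close>, so Conway's distance is \<open>det A det B / g\<^sup>2\<close> with \<open>g\<close> the greatest common
  divisor of the entries of \<open>A adj(B)\<close> only. For matrices with coprime entries this \<open>g\<close> already divides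
  \<open>det A\<close> and \<open>det B\<close> (\<open>primitive_entry_gcd_dvd_det\<close>), hence is the index of the sum.

  Order: \<open>\<delta>(1, y) = det y\<close>, so the metric condition says \<open>det(x \<and> y) = det x\<close>, that is
  \<open>x \<and> y = x\<close>. Fundamental domain: the vertices of the big picture are the Hermite forms with coprime
  entries, the content of a matrix depends only on its class, and a Hermite form is unique in its class.
\<close>

section \<open>Contents and Hermite forms of integral matrices\<close>

definition entry_gcd :: "int^2^2 \<Rightarrow> int" where
  "entry_gcd A = gcd (gcd (A $ 1 $ 1) (A $ 1 $ 2)) (gcd (A $ 2 $ 1) (A $ 2 $ 2))"

lemma dvd_entry_gcd_iff: "k dvd entry_gcd A \<longleftrightarrow> (\<forall>i j. k dvd A $ i $ j)"
  by (auto simp: entry_gcd_def forall_2)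

lemma entry_gcd_dvd: "entry_gcd A dvd A $ i $ j"
  using dvd_entry_gcd_iff dvd_refl by blast

lemma entry_gcd_nonneg: "0 \<le> entry_gcd A"
  by (simp add: entry_gcd_def)

lemma entry_gcd_dvd_mult:
  shows "entry_gcd A dvd entry_gcd (A ** B)" "entry_gcd B dvd entry_gcd (A ** B)"
  by (simp_all add: dvd_entry_gcd_iff mat2_mult_nth entry_gcd_dvd)

lemma entry_gcd_dvd_det: "entry_gcd A dvd det A"
  by (simp add: det_2 entry_gcd_dvd)

lemma entry_gcd_pos: "det A \<noteq> 0 \<Longrightarrow> 0 < entry_gcd A"
  using entry_gcd_dvd_det[of A] entry_gcd_nonneg[of A] by (cases "entry_gcd A = 0") auto

lemma entry_gcd_gl2_equiv:
  assumes "gl2_equiv A B"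
  shows "entry_gcd A = entry_gcd B"
proof (rule zdvd_antisym_nonneg)
  show "entry_gcd A dvd entry_gcd B"
    using assms entry_gcd_dvd_mult(2) by (auto simp: gl2_equiv_def)
  show "entry_gcd B dvd entry_gcd A"
    using gl2_equiv_sym[OF assms] entry_gcd_dvd_mult(2) by (auto simp: gl2_equiv_def)
qed (rule entry_gcd_nonneg)+

lemma entry_gcd_scale: "entry_gcd (map_matrix ((*) k) A) = \<bar>k\<bar> * entry_gcd A"
  by (simp add: entry_gcd_def flip: gcd_mult_distrib_int)

lemma det_scale: "det (map_matrix ((*) k) A) = k\<^sup>2 * det (A :: int^2^2)"
  by (simp add: det_2 power2_eq_square algebra_simps)

lemma content_decomposition:
  assumes "det A \<noteq> 0"
  obtains n A' where "0 < n" "A = map_matrix ((*) (int n)) A'" "entry_gcd A' = 1" "det A' \<noteq> 0"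
proof
  let ?g = "entry_gcd A"
  let ?A' = "map_matrix (\<lambda>x. x div ?g) A"
  have g: "0 < ?g" using assms by (rule entry_gcd_pos)
  show "0 < nat ?g" using g by simp
  show *: "A = map_matrix ((*) (int (nat ?g))) ?A'"
    using g by (simp add: vec_eq_iff entry_gcd_dvd)
  show "det ?A' \<noteq> 0" using assms * by (metis det_scale mult_zero_right)
  have "?g = \<bar>int (nat ?g)\<bar> * entry_gcd ?A'" using * entry_gcd_scale by metis
  then show "entry_gcd ?A' = 1" using g by simp
qed

lemma invertible_int_iff: "invertible (U :: int^2^2) \<longleftrightarrow> \<bar>det U\<bar> = 1"
proof
  assume "\<bar>det U\<bar> = 1"
  then have d: "det U * det U = 1" by (metis abs_mult_self_eq mult_1)
  have c: "P ** mat k = mat k ** P" for P :: "int^2^2" and k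
    by (rule mat2_eqI; simp add: mat2_mult_nth mat_def)
  have m: "mat (det U) ** mat (det U) = (mat 1 :: int^2^2)"
    using d by (intro mat2_eqI) (simp_all add: mat2_mult_nth mat_def)
  have "U ** (mat (det U) ** adj2 U) = mat 1" "(mat (det U) ** adj2 U) ** U = mat 1"
    by (metis adj2_mult c m matrix_mul_assoc)+
  then show "invertible U" unfolding invertible_def by blast
qed (rule invertible_det_int)

definition upper :: "int \<Rightarrow> int \<Rightarrow> int \<Rightarrow> int^2^2" where
  "upper a b d = vector [vector [a, b], vector [0, d]]"

lemma upper_nth [simp]:
  "upper a b d $ 1 $ 1 = a" "upper a b d $ 1 $ 2 = b" "upper a b d $ 2 $ 1 = 0" "upper a b d $ 2 $ 2 = d"
  by (simp_all add: upper_def)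

lemma det_upper [simp]: "det (upper a b d) = a * d"
  by (simp add: det_2)

lemma upper_mult: "upper a b d ** upper a' b' d' = upper (a * a') (a * b' + b * d') (d * d')"
  by (rule mat2_eqI; simp add: mat2_mult_nth)

text \<open>
  Bezout coefficients of the first column make the lower left entry vanish. The remaining freedom, the
  signs of the rows and adding multiples of the second row to the first, normalises the other entries.
\<close>

lemma hermite_form:
  assumes "det A \<noteq> 0"
  obtains a b d where "0 < a" "0 < d" "0 \<le> b" "b < d" "gl2_equiv A (upper a b d)"
proof -
  define x y where "x = A $ 1 $ 1" and "y = A $ 2 $ 1"
  define g where "g = gcd x y"
  have "\<not> (x = 0 \<and> y = 0)" using assms by (auto simp: det_2 x_def y_def)
  then have g: "0 < g" by (auto simp: g_def)
  obtain u v where uv: "u * x + v * y = g" unfolding g_def using bezout_int by blast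
  obtain x' y' where xy': "x = g * x'" "y = g * y'"
    using gcd_dvd1[of x y] gcd_dvd2[of x y] unfolding g_def by (meson dvdE)
  have one: "u * x' + v * y' = 1"
  proof -
    have "g * (u * x' + v * y') = g * 1" using uv by (simp add: xy' algebra_simps)
    then show ?thesis using g by simp
  qed
  define U :: "int^2^2" where "U = vector [vector [u, v], vector [- y', x']]"
  have dU: "det U = 1" using one by (simp add: U_def det_2 algebra_simps)
  \<comment> \<open>\<open>U\<close> puts \<open>g\<close> and \<open>0\<close> in the first column; \<open>V\<close> below turns \<open>d0\<close> into \<open>\<bar>d0\<bar>\<close> and reduces \<open>e\<close> modulo it.\<close>
  define e d0 where "e = (U ** A) $ 1 $ 2" and "d0 = (U ** A) $ 2 $ 2"
  have UA: "U ** A = upper g e d0"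
    by (rule mat2_eqI; simp add: e_def d0_def)
      (use uv xy' in \<open>simp_all add: mat2_mult_nth U_def x_def y_def algebra_simps\<close>)
  have "det A = g * d0" using arg_cong[OF UA, of det] by (simp add: det_mul dU)
  then have d0: "d0 \<noteq> 0" using assms by auto
  define d where "d = \<bar>d0\<bar>"
  define V where "V = upper 1 (- (e div d) * sgn d0) (sgn d0)"
  have VU: "V ** U ** A = upper g (e mod d) d"
    by (simp add: matrix_mul_assoc[symmetric] UA V_def upper_mult)
      (simp add: d_def sgn_mult_abs abs_sgn minus_div_mult_eq_mod[symmetric] algebra_simps)
  have "invertible (V ** U)"
    using d0 by (simp add: invertible_int_iff det_mul dU V_def)
  moreover have d: "0 < d" using d0 by (simp add: d_def)
  ultimately have "gl2_equiv A (upper g (e mod d) d)"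
    using assms VU g unfolding gl2_equiv_def by (metis det_upper less_irrefl mult_eq_0_iff)
  then show thesis using that[of g d "e mod d"] g d by simp
qed

text \<open>
  A matrix carrying one Hermite form to another is itself upper triangular with positive diagonal, hence
  unipotent, and it can only move the upper right entry within its residue class.
\<close>

lemma hermite_form_unique:
  assumes "gl2_equiv (upper a b d) (upper a' b' d')"
    and "0 < a" "0 < a'" "0 \<le> b" "b < d" "0 \<le> b'" "b' < d'"
  shows "a = a' \<and> b = b' \<and> d = d'"
proof -
  obtain U where U: "invertible U" "upper a' b' d' = U ** upper a b d"
    using assms(1) by (auto simp: gl2_equiv_def)
  note e = arg_cong[OF U(2), of "\<lambda>M. M $ i $ j" for i j]
  have "U $ 2 $ 1 = 0" using e[of 2 1] assms by (simp add: mat2_mult_nth)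
  moreover have "U $ 1 $ 1 * a = a'" "U $ 2 $ 2 * d = d'"
    using e[of 1 1] e[of 2 2] calculation by (simp_all add: mat2_mult_nth)
  moreover have "0 < U $ 1 $ 1" "0 < U $ 2 $ 2"
    using calculation assms by (auto simp: zero_less_mult_iff dest: less_trans)
      (smt (verit) zero_less_mult_iff)+
  moreover have "U $ 1 $ 1 * U $ 2 $ 2 = 1"
    using invertible_det_int[OF U(1)] calculation by (simp add: det_2 abs_mult)
  ultimately have one: "U $ 1 $ 1 = 1" "U $ 2 $ 2 = 1" "a = a'" "d = d'"
    using zmult_eq_1_iff by auto
  have "b' = b + U $ 1 $ 2 * d" using e[of 1 2] one by (simp add: mat2_mult_nth)
  then have "b' mod d = b mod d" by simp
  then show ?thesis using one assms by (simp add: mod_pos_pos_trivial)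
qed

text \<open>
  A proper inclusion of lattices factors through one of prime index: a prime divisor of a diagonal entry
  of the Hermite form can be split off on the left.
\<close>

lemma prime_left_factor:
  fixes M :: "int^2^2"
  assumes "1 < \<bar>det M\<bar>"
  obtains p P Q where "prime p" "M = P ** Q" "\<bar>det P\<bar> = int p"
proof -
  have "det M \<noteq> 0" using assms by auto
  then obtain a b d where h: "0 < a" "0 < d" "gl2_equiv M (upper a b d)"
    by (rule hermite_form)
  obtain V where V: "invertible V" "M = V ** upper a b d"
    using gl2_equiv_sym[OF h(3)] by (auto simp: gl2_equiv_def)
  have dV: "\<bar>det V\<bar> = 1" using V(1) by (rule invertible_det_int)
  have ad: "a * d \<noteq> 1" using assms V(2) dV by (auto simp: det_mul abs_mult)
  show thesis
  proof (cases "d = 1")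
    case False
    have "nat d \<noteq> 1" using False h by auto
    then obtain p where p: "prime p" "p dvd nat d"
      using prime_factor_nat by blast
    then have "int p dvd d" using h by (simp flip: int_dvd_int_iff)
    then obtain e where e: "d = int p * e" by (elim dvdE)
    have "M = (V ** upper 1 0 (int p)) ** upper a b e"
      using V(2) by (simp add: matrix_mul_assoc[symmetric] upper_mult e)
    then show ?thesis using that[OF p(1)] dV by (simp add: det_mul abs_mult)
  next
    case True
    have "nat a \<noteq> 1" using True h ad by auto
    then obtain p where p: "prime p" "p dvd nat a"
      using prime_factor_nat by blast
    then have "int p dvd a" using h by (simp flip: int_dvd_int_iff)
    then obtain e where e: "a = int p * e" by (elim dvdE)
    have "M = (V ** upper (int p) b 1) ** upper e 0 1"
      using V(2) by (simp add: matrix_mul_assoc[symmetric] upper_mult e True)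
    then show ?thesis using that[OF p(1)] dV by (simp add: det_mul abs_mult)
  qed
qed

section \<open>Determinants of classes and meets\<close>

lemma cdet_pos: "0 < cdet a"
  by (rule abs_ns_class_cases[of a]) (simp add: cdet_abs)

lemma abs_ns_class_eq_iff:
  "det A \<noteq> 0 \<Longrightarrow> det B \<noteq> 0 \<Longrightarrow> abs_ns_class A = abs_ns_class B \<longleftrightarrow> gl2_equiv A B"
  using Quotient_rel[OF Quotient_ns_class, of A B] by (simp add: gl2_equiv_refl)

lemma le_cdet_dvd:
  assumes "a \<le> b"
  shows "cdet a dvd cdet b"
proof -
  obtain A where A: "det A \<noteq> 0" "a = abs_ns_class A" by (rule abs_ns_class_cases)
  obtain B where B: "det B \<noteq> 0" "b = abs_ns_class B" by (rule abs_ns_class_cases)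
  have "mat2_le A B" using assms A B by (simp add: less_eq_abs)
  then show ?thesis using A B by (auto simp: mat2_le_def cdet_abs det_mul abs_mult nat_mult_distrib)
qed

lemma le_cdet_eq:
  assumes "a \<le> b" "cdet a = cdet b"
  shows "a = b"
proof -
  obtain A where A: "det A \<noteq> 0" "a = abs_ns_class A" by (rule abs_ns_class_cases)
  obtain B where B: "det B \<noteq> 0" "b = abs_ns_class B" by (rule abs_ns_class_cases)
  have "mat2_le A B" using assms A B by (simp add: less_eq_abs)
  then obtain M where M: "B = M ** A" by (auto simp: mat2_le_def)
  have "int (cdet a) = int (cdet b)" using assms(2) by simp
  then have "\<bar>det A\<bar> = \<bar>det M\<bar> * \<bar>det A\<bar>" using A B M by (simp add: cdet_abs det_mul abs_mult)
  then have "\<bar>det M\<bar> = 1" using A(1) by simp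
  then have "gl2_equiv A B" using A B M by (auto simp: gl2_equiv_def invertible_int_iff)
  then show ?thesis using A B by (simp add: abs_ns_class_eq_iff)
qed

text \<open>
  The minor formula for the index of a sum of row lattices. All six minors are multiples of the
  determinant of a common right divisor \<open>Z\<close>; conversely \<open>det X\<close> is an integral combination of the
  minors as soon as \<open>X = U A + V B\<close>.
\<close>

lemma cdet_inf:
  assumes A: "det A \<noteq> 0" and B: "det B \<noteq> 0"
  shows "int (cdet (inf (abs_ns_class A) (abs_ns_class B))) =
    gcd (gcd (det A) (det B)) (entry_gcd (A ** adj2 B))" (is "?g = ?r")
proof -
  let ?E = "A ** adj2 B"
  obtain Z where Z: "det Z \<noteq> 0" "inf (abs_ns_class A) (abs_ns_class B) = abs_ns_class Z"
    by (rule abs_ns_class_cases)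
  have g: "?g = \<bar>det Z\<bar>" using Z by (simp add: cdet_abs)
  have "abs_ns_class Z \<le> abs_ns_class A" "abs_ns_class Z \<le> abs_ns_class B"
    by (simp_all flip: Z(2))
  then obtain P Q where PQ: "A = P ** Z" "B = Q ** Z"
    using A B Z by (auto simp: less_eq_abs mat2_le_def)
  have "?E = mat (det Z) ** (P ** adj2 Q)"
    by (rule mat2_eqI; simp add: mat2_mult_nth adj2_def PQ mat_def det_2 algebra_simps)
  then have "det Z dvd entry_gcd ?E"
    by (simp add: dvd_entry_gcd_iff mat2_mult_nth mat_def)
  moreover have "det Z dvd det A" "det Z dvd det B" by (simp_all add: PQ det_mul)
  ultimately have gr: "?g dvd ?r" by (simp add: g)
  obtain X U V where X: "det X \<noteq> 0" "X = U ** A + V ** B" "mat2_le X A" "mat2_le X B"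
    using mat2_gcrd[OF A B] by blast
  have "abs_ns_class X \<le> abs_ns_class Z"
    unfolding Z(2)[symmetric] using X A B by (intro inf_greatest) (simp_all add: less_eq_abs)
  then have "cdet (abs_ns_class X) dvd cdet (abs_ns_class Z)" by (rule le_cdet_dvd)
  then have "\<bar>det X\<bar> dvd \<bar>det Z\<bar>" using X(1) Z(1) by (simp add: cdet_abs nat_dvd_iff)
  then have "det X dvd ?g" by (simp add: g)
  moreover have "?r dvd det X"
  proof -
    \<comment> \<open>Cauchy--Binet for the product of \<open>(U V)\<close> with the matrix stacking \<open>A\<close> above \<open>B\<close>.\<close>
    have "det X = det U * det A + det V * det B
        + (U $ 1 $ 1 * V $ 2 $ 2 - V $ 1 $ 2 * U $ 2 $ 1) * ?E $ 1 $ 1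
        - (U $ 1 $ 1 * V $ 2 $ 1 - V $ 1 $ 1 * U $ 2 $ 1) * ?E $ 1 $ 2
        + (U $ 1 $ 2 * V $ 2 $ 2 - V $ 1 $ 2 * U $ 2 $ 2) * ?E $ 2 $ 1
        - (U $ 1 $ 2 * V $ 2 $ 1 - V $ 1 $ 1 * U $ 2 $ 2) * ?E $ 2 $ 2"
      unfolding X(2) by (simp add: det_2 mat2_mult_nth adj2_def algebra_simps)
    moreover have "?r dvd ?E $ i $ j" for i j
      using entry_gcd_dvd by (metis dvd_trans gcd_dvd2)
    moreover have "?r dvd det A" "?r dvd det B"
      by (metis dvd_trans gcd_dvd1 gcd_dvd2)+
    ultimately show ?thesis by (simp add: dvd_add dvd_diff)
  qed
  ultimately have "?r dvd ?g" by (blast intro: dvd_trans)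
  with gr show ?thesis by (intro zdvd_antisym_nonneg) simp_all
qed

text \<open>
  In terms of lattices, \<open>[L\<^sub>a + L\<^sub>c : L\<^sub>b + L\<^sub>c] \<le> [L\<^sub>a : L\<^sub>b]\<close>. If \<open>B = M A\<close>, multiplying \<open>B adj(C)\<close> by
  \<open>adj(M)\<close> gives \<open>det M\<close> times \<open>A adj(C)\<close>, so \<open>det M\<close> times each minor of the pair \<open>A, C\<close> is a
  combination of minors of the pair \<open>B, C\<close>. Working with minors matters here: the inclusion of
  \<open>(det M) L\<^sub>a\<close> in \<open>L\<^sub>b\<close> alone would only bound the index by \<open>(det M)\<^sup>2\<close>.
\<close>

lemma cdet_inf_index:
  assumes "a \<le> b"
  shows "cdet (inf b c) * cdet a \<le> cdet (inf a c) * cdet b"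
proof -
  obtain A where A: "det A \<noteq> 0" "a = abs_ns_class A" by (rule abs_ns_class_cases)
  obtain B where B: "det B \<noteq> 0" "b = abs_ns_class B" by (rule abs_ns_class_cases)
  obtain C where C: "det C \<noteq> 0" "c = abs_ns_class C" by (rule abs_ns_class_cases)
  have "mat2_le A B" using assms A B by (simp add: less_eq_abs)
  then obtain M where M: "B = M ** A" "det M \<noteq> 0" by (auto simp: mat2_le_def)
  let ?g = "int (cdet (inf a c))" and ?h = "int (cdet (inf b c))" and ?m = "det M"
  have dvd_gcd: "k dvd ?m * gcd x y" if "k dvd ?m * x" "k dvd ?m * y" for k x y
    using that by (metis abs_mult abs_of_nonneg dvd_abs_iff gcd_ge_0_int gcd_greatest gcd_mult_distrib_int)
  have h: "?h dvd det B" "?h dvd det C" "?h dvd entry_gcd (B ** adj2 C)"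
    using cdet_inf[OF B(1) C(1)] unfolding B(2)[symmetric] C(2)[symmetric]
    by (metis dvd_refl gcd_greatest_iff)+
  have "map_matrix ((*) ?m) (A ** adj2 C) = adj2 M ** (B ** adj2 C)"
    by (rule mat2_eqI; simp add: M(1) mat2_mult_nth adj2_def det_2 algebra_simps)
  then have "?h dvd entry_gcd (map_matrix ((*) ?m) (A ** adj2 C))"
    using h(3) entry_gcd_dvd_mult(2) by (metis dvd_trans)
  then have "?h dvd ?m * entry_gcd (A ** adj2 C)"
    unfolding entry_gcd_def[of "A ** adj2 C"] dvd_entry_gcd_iff by (intro dvd_gcd) simp_all
  moreover have "?h dvd ?m * det A" "?h dvd ?m * det C"
    using h by (simp_all add: M(1) det_mul)
  ultimately have "?h dvd ?m * ?g"
    unfolding A(2) C(2) cdet_inf[OF A(1) C(1)] by (intro dvd_gcd)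
  then have "?h dvd \<bar>?m\<bar> * ?g" by (metis abs_mult abs_of_nat dvd_abs_iff)
  then have "?h \<le> \<bar>?m\<bar> * ?g"
    using M(2) cdet_pos[of "inf a c"] by (intro zdvd_imp_le) simp_all
  then have "?h * int (cdet a) \<le> (\<bar>?m\<bar> * ?g) * int (cdet a)" by (rule mult_right_mono) simp
  also have "\<dots> = ?g * int (cdet b)"
    using A B M by (simp add: cdet_abs det_mul abs_mult)
  finally show ?thesis by (simp flip: of_nat_mult)
qed

section \<open>The extended hyper-distance as a weighted path metric\<close>

lemma ext_hyper_dist_mult: "ext_hyper_dist a b * (cdet (inf a b))\<^sup>2 = cdet a * cdet b"
proof -
  obtain A' B' X where *: "det A' \<noteq> 0" "det B' \<noteq> 0" "det X \<noteq> 0" "inf a b = abs_ns_class X"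
    "a = abs_ns_class (A' ** X)" "b = abs_ns_class (B' ** X)"
    "ext_hyper_dist a b = nat \<bar>det A'\<bar> * nat \<bar>det B'\<bar>"
    using theI'[OF ext_hyper_dist_ex1[of a b]] unfolding ext_hyper_dist_def[symmetric] by blast
  have "cdet (inf a b) = nat \<bar>det X\<bar>" using * by (simp add: cdet_abs)
  moreover have "cdet a = nat \<bar>det A'\<bar> * nat \<bar>det X\<bar>" "cdet b = nat \<bar>det B'\<bar> * nat \<bar>det X\<bar>"
    by (subst *, use * in \<open>simp add: cdet_abs det_mul abs_mult nat_mult_distrib\<close>)+
  ultimately show ?thesis using * by (simp add: power2_eq_square)
qed

lemma ext_hyper_dist_pos: "0 < ext_hyper_dist a b"
  using ext_hyper_dist_mult[of a b] cdet_pos[of a] cdet_pos[of b] by (cases "ext_hyper_dist a b") auto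

lemma ext_hyper_dist_self: "ext_hyper_dist a a = 1"
  using ext_hyper_dist_mult[of a a] cdet_pos[of a] by (simp add: power2_eq_square)

text \<open>
  Going up an edge, \<open>det\<close> grows by \<open>p\<close> while the determinant of the meet with \<open>b\<close> grows by at most \<open>p\<close>;
  going down, \<open>det\<close> shrinks by \<open>p\<close> and the meet cannot grow.
\<close>

lemma ext_hyper_dist_edge:
  assumes "ns_edge a p c \<or> ns_edge c p a"
  shows "ext_hyper_dist a b \<le> p * ext_hyper_dist c b"
proof -
  let ?f = "cdet (inf a b)" and ?f' = "cdet (inf c b)"
  have "ext_hyper_dist a b * ?f'\<^sup>2 \<le> p * ext_hyper_dist c b * ?f'\<^sup>2"
    using assms
  proof
    assume "ns_edge a p c"
    then have e: "a \<le> c" "cdet c = p * cdet a" by (simp_all add: ns_edge_def)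
    have "?f' \<le> p * ?f" using cdet_inf_index[OF e(1), of b] cdet_pos[of a] by (simp add: e(2) mult.commute)
    then have "?f'\<^sup>2 \<le> (p * ?f)\<^sup>2" by (rule power_mono) simp
    then have "ext_hyper_dist a b * ?f'\<^sup>2 \<le> ext_hyper_dist a b * (p * ?f)\<^sup>2" by (rule mult_left_mono) simp
    also have "\<dots> = p\<^sup>2 * (ext_hyper_dist a b * ?f\<^sup>2)" by (simp add: power_mult_distrib)
    also have "\<dots> = p * (ext_hyper_dist c b * ?f'\<^sup>2)"
      unfolding ext_hyper_dist_mult e(2) by (simp add: power2_eq_square)
    finally show ?thesis by (simp add: mult.assoc)
  next
    assume "ns_edge c p a"
    then have e: "c \<le> a" "cdet a = p * cdet c" by (simp_all add: ns_edge_def)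
    have "?f' \<le> ?f" using e(1) cdet_pos by (intro dvd_imp_le le_cdet_dvd inf_mono) auto
    then have "?f'\<^sup>2 \<le> ?f\<^sup>2" by (rule power_mono) simp
    then have "ext_hyper_dist a b * ?f'\<^sup>2 \<le> ext_hyper_dist a b * ?f\<^sup>2" by (rule mult_left_mono) simp
    also have "\<dots> = p * (ext_hyper_dist c b * ?f'\<^sup>2)"
      unfolding ext_hyper_dist_mult e(2) by simp
    finally show ?thesis by (simp add: mult.assoc)
  qed
  then show ?thesis using cdet_pos[of "inf c b"] by simp
qed

lemma ln_ext_hyper_dist_le_cost:
  "ns_graph.awalk a w b \<Longrightarrow> ln (real (ext_hyper_dist a b)) \<le> ns_graph.awalk_cost ns_weight w"
proof (induction w arbitrary: a)
  case Nil
  then show ?case by (simp add: ns_graph.awalk_Nil_iff ext_hyper_dist_self)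
next
  case (Cons e w)
  obtain x p c where e: "e = (x, p, c)" by (cases e) auto
  have edge: "ns_edge a p c \<or> ns_edge c p a" and w: "ns_graph.awalk c w b"
    using Cons.prems by (auto simp: ns_graph.awalk_Cons_iff e) (auto simp: ns_graph_def)
  have p: "0 < p" using edge by (auto simp: ns_edge_def prime_gt_0_nat)
  have "ln (real (ext_hyper_dist a b)) \<le> ln (real (p * ext_hyper_dist c b))"
    using ext_hyper_dist_edge[OF edge, of b] ext_hyper_dist_pos[of a b] by (intro ln_mono) (simp_all flip: of_nat_mult)
  also have "\<dots> = ln (real p) + ln (real (ext_hyper_dist c b))"
    using p ext_hyper_dist_pos[of c b] by (simp add: ln_mult)
  also have "\<dots> \<le> ns_weight e + ns_graph.awalk_cost ns_weight w"
    using Cons.IH[OF w] by (simp add: e ns_weight_def)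
  finally show ?case by (simp add: ns_graph.awalk_cost_Cons)
qed

lemma edge_below:
  assumes "a \<le> b" "a \<noteq> b"
  obtains p z where "a \<le> z" "ns_edge z p b"
proof -
  obtain A where A: "det A \<noteq> 0" "a = abs_ns_class A" by (rule abs_ns_class_cases)
  obtain B where B: "det B \<noteq> 0" "b = abs_ns_class B" by (rule abs_ns_class_cases)
  have "mat2_le A B" using assms A B by (simp add: less_eq_abs)
  then obtain M where M: "B = M ** A" "det M \<noteq> 0" by (auto simp: mat2_le_def)
  have "\<bar>det M\<bar> \<noteq> 1"
    using le_cdet_eq[OF assms(1)] assms(2) A B M by (auto simp: cdet_abs det_mul abs_mult)
  then have "1 < \<bar>det M\<bar>" using M(2) by linarith
  then obtain p P Q where PQ: "prime p" "M = P ** Q" "\<bar>det P\<bar> = int p" by (rule prime_left_factor)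
  have d: "det Q \<noteq> 0" "det P \<noteq> 0" "det (Q ** A) \<noteq> 0" using M PQ A by (auto simp: det_mul)
  show thesis
  proof
    show "a \<le> abs_ns_class (Q ** A)"
      using A d by (auto simp: less_eq_abs mat2_le_def)
    have "mat2_le (Q ** A) B" using M PQ d by (auto simp: mat2_le_def matrix_mul_assoc)
    moreover have "nat \<bar>det B\<bar> = p * nat \<bar>det (Q ** A)\<bar>"
      using M PQ by (simp add: det_mul abs_mult nat_mult_distrib)
    ultimately show "ns_edge (abs_ns_class (Q ** A)) p b"
      using B d PQ by (simp add: ns_edge_def less_eq_abs cdet_abs)
  qed
qed

text \<open>
  Both directions are built in the same induction, because a geodesic descends from \<open>a\<close> to the meet and
  then ascends to \<open>b\<close>.
\<close>

lemma walks_along_chain: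
  assumes "a \<le> b"
  shows "\<exists>w w'. ns_graph.awalk a w b \<and> ns_graph.awalk b w' a \<and>
    ns_graph.awalk_cost ns_weight w = ln (real (cdet b)) - ln (real (cdet a)) \<and>
    ns_graph.awalk_cost ns_weight w' = ln (real (cdet b)) - ln (real (cdet a))"
  using assms
proof (induction "cdet b" arbitrary: b rule: less_induct)
  case less
  show ?case
  proof (cases "a = b")
    case True
    then show ?thesis by (intro exI[of _ "[]"]) (simp add: ns_graph.awalk_Nil_iff, simp add: ns_graph_def)
  next
    case False
    then obtain p z where z: "a \<le> z" "ns_edge z p b" using edge_below less.prems by blast
    have p: "1 < p" and b: "cdet b = p * cdet z"
      using z(2) prime_gt_1_nat by (auto simp: ns_edge_def)
    have "cdet z < cdet b" using p cdet_pos[of z] by (simp add: b)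
    then obtain w w' where w: "ns_graph.awalk a w z" "ns_graph.awalk z w' a"
      "ns_graph.awalk_cost ns_weight w = ln (real (cdet z)) - ln (real (cdet a))"
      "ns_graph.awalk_cost ns_weight w' = ln (real (cdet z)) - ln (real (cdet a))"
      using less.hyps z(1) by blast
    have "ns_graph.awalk z [(z, p, b)] b"
      using z(2) by (simp add: ns_graph.awalk_simps) (simp add: ns_graph_def)
    then have 1: "ns_graph.awalk a (w @ [(z, p, b)]) b" using w(1) by (rule ns_graph.awalk_appendI[rotated])
    have 2: "ns_graph.awalk b ((b, p, z) # w') a"
      using z(2) w(2) by (simp add: ns_graph.awalk_Cons_iff) (simp add: ns_graph_def)
    have 3: "ln (real (cdet b)) = ln (real p) + ln (real (cdet z))"
      using p cdet_pos[of z] by (simp add: b ln_mult)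
    show ?thesis
      by (rule exI[of _ "w @ [(z, p, b)]"], rule exI[of _ "(b, p, z) # w'"])
        (use 1 2 3 w(3,4) in \<open>simp add: ns_weight_def ns_graph.awalk_cost_append ns_graph.awalk_cost_Cons
          del: ns_graph.awalk_append_iff\<close>)
  qed
qed

lemma is_weighted_dist_ext_hyper_dist: "is_weighted_dist a b (ln (real (ext_hyper_dist a b)))"
proof -
  let ?x = "inf a b"
  obtain w where w: "ns_graph.awalk a w ?x"
    "ns_graph.awalk_cost ns_weight w = ln (real (cdet a)) - ln (real (cdet ?x))"
    using walks_along_chain[of ?x a] by auto
  obtain v where v: "ns_graph.awalk ?x v b"
    "ns_graph.awalk_cost ns_weight v = ln (real (cdet b)) - ln (real (cdet ?x))"
    using walks_along_chain[of ?x b] by auto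
  have "real (ext_hyper_dist a b) = real (cdet a) * real (cdet b) / (real (cdet ?x))\<^sup>2"
    using arg_cong[OF ext_hyper_dist_mult[of a b], of real] cdet_pos[of ?x] by (simp add: field_simps)
  then have "ln (real (ext_hyper_dist a b)) = ns_graph.awalk_cost ns_weight (w @ v)"
    using cdet_pos[of a] cdet_pos[of b] cdet_pos[of ?x]
    by (simp add: w v ln_div ln_mult ln_realpow ns_graph.awalk_cost_append)
  moreover have "ns_graph.awalk a (w @ v) b" using w(1) v(1) by (rule ns_graph.awalk_appendI)
  ultimately show ?thesis
    using ln_ext_hyper_dist_le_cost[of a _ b] unfolding is_weighted_dist_def by metis
qed

section \<open>Conway's hyper-distance of integral matrices\<close>

text \<open>
  This makes the least scaling of an integral matrix exactly the reciprocal of its content: a scalar that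
  clears all entries clears their greatest common divisor.
\<close>

lemma mult_gcd_in_Ints:
  fixes t :: "'a :: comm_ring_1"
  assumes "t * of_int x \<in> \<int>" "t * of_int y \<in> \<int>"
  shows "t * of_int (gcd x y) \<in> \<int>"
proof -
  obtain u v where uv: "u * x + v * y = gcd x y" using bezout_int by blast
  have "t * of_int (gcd x y) = t * of_int x * of_int u + t * of_int y * of_int v"
    by (simp add: algebra_simps flip: uv)
  then show ?thesis using assms by auto
qed

definition scaled_mat :: "rat \<Rightarrow> int^2^2 \<Rightarrow> rat^2^2" where
  "scaled_mat c A = map_matrix (\<lambda>x. c * of_int x) A"

lemma scaled_mat_mult: "scaled_mat c A ** scaled_mat d B = scaled_mat (c * d) (A ** B)"
  by (rule mat2_eqI; simp add: scaled_mat_def mat2_mult_nth algebra_simps)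

lemma scale_scaled_mat: "map_matrix ((*) s) (scaled_mat c A) = scaled_mat (s * c) A"
  by (simp add: scaled_mat_def vec_eq_iff mult.assoc)

lemma det_scaled_mat: "det (scaled_mat c A) = c\<^sup>2 * of_int (det A)"
  by (simp add: scaled_mat_def det_2 power2_eq_square algebra_simps)

lemma min_scaling_scaled_mat:
  assumes "0 < c" "0 < entry_gcd E"
  shows "min_scaling (scaled_mat c E) = 1 / (c * of_int (entry_gcd E))"
  unfolding min_scaling_def
proof (rule Least_equality)
  let ?g = "entry_gcd E"
  have "1 / (c * of_int ?g) * (c * of_int (E $ i $ j)) = of_int (E $ i $ j div ?g)" for i j
  proof -
    obtain k where "E $ i $ j = ?g * k" using entry_gcd_dvd[of E i j] by (elim dvdE)
    then show ?thesis using assms by simp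
  qed
  then show "0 < 1 / (c * of_int ?g) \<and>
      integral_mat (map_matrix ((*) (1 / (c * of_int ?g))) (scaled_mat c E))"
    using assms by (simp add: scaled_mat_def integral_mat_def)
  fix s assume s: "0 < s \<and> integral_mat (map_matrix ((*) s) (scaled_mat c E))"
  then have "(s * c) * of_int (E $ i $ j) \<in> \<int>" for i j
    by (simp add: scaled_mat_def integral_mat_def mult.assoc)
  then have "(s * c) * of_int ?g \<in> \<int>"
    unfolding entry_gcd_def by (intro mult_gcd_in_Ints)
  then obtain k where k: "(s * c) * of_int ?g = of_int k" by (rule Ints_cases)
  have "0 < (s * c) * of_int ?g" using s assms by (intro mult_pos_pos) simp_all
  then have "1 \<le> k" unfolding k by simp
  then have "1 \<le> (s * c) * of_int ?g" unfolding k by simp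
  then have "1 \<le> s * (c * of_int ?g)" by (simp only: mult.assoc)
  moreover have "0 < c * of_int ?g" using assms by (intro mult_pos_pos) simp_all
  ultimately show "1 / (c * of_int ?g) \<le> s" by (simp only: pos_divide_le_eq)
qed

lemma matrix_inv_scaled_mat:
  assumes "c \<noteq> 0" "det B \<noteq> 0"
  shows "matrix_inv (scaled_mat c B) = scaled_mat (1 / (c * of_int (det B))) (adj2 B)"
proof (rule matrix_inv_unique_rat)
  have "scaled_mat (1 / of_int n) (mat n) = mat 1" if "n \<noteq> 0" for n
    using that by (intro mat2_eqI) (simp_all add: scaled_mat_def mat_def)
  moreover have "1 / (c * of_int (det B)) * c = 1 / of_int (det B)" using assms by simp
  ultimately show "scaled_mat (1 / (c * of_int (det B))) (adj2 B) ** scaled_mat c B = mat 1"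
    using assms(2) unfolding scaled_mat_mult adj2_mult by simp
qed

lemma hyper_dist_scaled_mat:
  assumes "0 < c" "0 < c'" "det A \<noteq> 0" "0 < det B"
  shows "hyper_dist_mat (scaled_mat c A) (scaled_mat c' B) =
    of_int (det A * det B) / (of_int (entry_gcd (A ** adj2 B)))\<^sup>2"
proof -
  define E where "E = A ** adj2 B"
  have "det (adj2 B) = det B" by (simp add: adj2_def det_2)
  then have dE: "det E = det A * det B" by (simp add: E_def det_mul)
  then have "det E \<noteq> 0" using assms by simp
  then have g: "0 < entry_gcd E" by (rule entry_gcd_pos)
  define k where "k = c * (1 / (c' * of_int (det B)))"
  have k: "0 < k" using assms by (simp add: k_def)
  have "scaled_mat c A ** matrix_inv (scaled_mat c' B) = scaled_mat k E"
    using assms by (simp add: matrix_inv_scaled_mat scaled_mat_mult k_def E_def)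
  then have "hyper_dist_mat (scaled_mat c A) (scaled_mat c' B) =
      (min_scaling (scaled_mat k E) * k)\<^sup>2 * of_int (det E)"
    by (simp only: hyper_dist_mat_def Let_def scale_scaled_mat det_scaled_mat)
  also have "min_scaling (scaled_mat k E) * k = 1 / of_int (entry_gcd E)"
    using k g by (simp add: min_scaling_scaled_mat)
  finally show ?thesis by (simp add: power_divide dE flip: E_def)
qed

lemma alpha_eq_upper:
  assumes "0 < d"
  shows "alpha (of_int a / of_int d) (of_int b / of_int d) = scaled_mat (1 / of_int d) (upper a b d)"
  using assms by (intro mat2_eqI) (simp_all add: alpha_def scaled_mat_def)

section \<open>Vertices of the big picture as primitive Hermite forms\<close>

text \<open>
  These are the matrices \<open>\<beta>\<^sub>X\<close>: minimality of the denominator \<open>N\<close> means that the entries are coprime, and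
  the choice of \<open>0 \<le> g / h < 1\<close> means that the form is reduced.
\<close>

definition primitive_hermite :: "int \<Rightarrow> int \<Rightarrow> int \<Rightarrow> bool" where
  "primitive_hermite a b d \<longleftrightarrow> 0 < a \<and> 0 < d \<and> 0 \<le> b \<and> b < d \<and> entry_gcd (upper a b d) = 1"

definition vertex :: "int \<Rightarrow> int \<Rightarrow> int \<Rightarrow> picture" where
  "vertex a b d = abs_picture (of_int a / of_int d, of_int b / of_int d)"

lemma denominator_alpha_coprime:
  assumes "0 < d" "entry_gcd (upper a b d) = 1"
  shows "denominator (alpha (of_int a / of_int d) (of_int b / of_int d)) = nat d"
  unfolding denominator_def
proof (rule Least_equality)
  show "0 < nat d \<and> integral_mat (map_matrix ((*) (of_nat (nat d))) (alpha (of_int a / of_int d) (of_int b / of_int d)))"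
    using assms(1) by (simp add: integral_mat_def alpha_def forall_2)
  fix N assume N: "0 < N \<and> integral_mat (map_matrix ((*) (of_nat N)) (alpha (of_int a / of_int d) (of_int b / of_int d)))"
  have dvd: "d dvd int N * x" if int: "(of_nat N * (of_int x / of_int d) :: rat) \<in> \<int>" for x
  proof -
    obtain k where "(of_nat N * (of_int x / of_int d) :: rat) = of_int k" using int by (rule Ints_cases)
    then have "(of_int (int N * x) :: rat) = of_int (d * k)" using assms(1) by (simp add: field_simps)
    then have "int N * x = d * k" by (simp only: of_int_eq_iff)
    then show ?thesis by simp
  qed
  have "d dvd entry_gcd (map_matrix ((*) (int N)) (upper a b d))"
    using N dvd by (auto simp: dvd_entry_gcd_iff forall_2 integral_mat_def alpha_def)
  then have "d dvd int N" using assms(2) by (simp add: entry_gcd_scale)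
  then show "nat d \<le> N" using N by (auto dest: zdvd_imp_le)
qed

lemma beta_vertex:
  assumes "primitive_hermite a b d"
  shows "beta (vertex a b d) = abs_ns_class (upper a b d)"
proof -
  have h: "0 < a" "0 < d" "0 \<le> b" "b < d" "entry_gcd (upper a b d) = 1"
    using assms by (simp_all add: primitive_hermite_def)
  have "picture_rel (of_int a / of_int d, of_int b / of_int d) (of_int a / of_int d, of_int b / of_int d)"
    using h by (simp add: picture_rel_def)
  moreover have "frac (of_int b / of_int d :: rat) = of_int b / of_int d"
    using h by (simp add: frac_eq)
  moreover have "beta_matrix (of_int a / of_int d) (of_int b / of_int d) = upper a b d"
    unfolding beta_matrix_def denominator_alpha_coprime[OF h(2,5)]
    using h by (intro mat2_eqI) (simp_all add: alpha_def)
  ultimately show ?thesis by (simp add: vertex_def beta.abs_eq)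
qed

text \<open>
  Clearing denominators of any representative and cancelling the content of the result gives the
  parameters.
\<close>

lemma vertex_cases:
  obtains a b d where "primitive_hermite a b d" "X = vertex a b d"
proof -
  have "picture_rel (rep_picture X) (rep_picture X)"
    using Quotient_picture by (rule Quotient_rep_reflp)
  moreover have X: "X = abs_picture (rep_picture X)"
    using Quotient_picture by (metis Quotient_abs_rep)
  moreover obtain M q where Mq: "rep_picture X = (M, q)" by (cases "rep_picture X")
  ultimately have M: "0 < M" by (simp add: picture_rel_def)
  define r where "r = frac q"
  have "picture_rel (M, q) (M, r)" using M by (simp add: picture_rel_def r_def frac_def)
  then have X: "X = abs_picture (M, r)"
    using X Mq Quotient_rel_abs[OF Quotient_picture] by metis
  define N where "N = denominator (alpha M r)"
  have N: "0 < N" "of_nat N * M \<in> \<int>" "of_nat N * r \<in> \<int>"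
    using denominator_alpha[of M r] by (auto simp: N_def integral_mat_def forall_2 alpha_def)
  then obtain u v where uv: "of_nat N * M = of_int u" "of_nat N * r = of_int v" by (auto elim!: Ints_cases)
  let ?T = "upper u v (int N)"
  define g where "g = entry_gcd ?T"
  have "0 < of_nat N * M" using M N by simp
  then have u: "0 < u" using uv by simp
  have g: "0 < g" unfolding g_def using u N by (intro entry_gcd_pos) simp
  have "g dvd u" "g dvd v" "g dvd int N"
    using entry_gcd_dvd[of ?T 1 1] entry_gcd_dvd[of ?T 1 2] entry_gcd_dvd[of ?T 2 2] by (simp_all add: g_def)
  then obtain a b d where abd: "u = g * a" "v = g * b" "int N = g * d" by (elim dvdE)
  have a: "0 < a" using u g by (simp add: abd zero_less_mult_iff)
  have "0 < g * d" using N by (simp flip: abd)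
  then have d: "0 < d" using g by (simp add: zero_less_mult_iff)
  have NQ: "(of_nat N :: rat) = of_int g * of_int d" using abd(3) by (metis of_int_mult of_int_of_nat_eq)
  have Md: "M = of_int a / of_int d" and rd: "r = of_int b / of_int d"
    using uv g d by (simp_all add: NQ abd field_simps)
  have "0 \<le> r" "r < 1" by (simp_all add: r_def frac_lt_1)
  then have b: "0 \<le> b" "b < d" using d by (simp_all add: rd zero_le_divide_iff)
  have "?T = map_matrix ((*) (int (nat g))) (upper a b d)"
    using g by (intro mat2_eqI) (simp_all add: abd)
  then have "g = \<bar>int (nat g)\<bar> * entry_gcd (upper a b d)" using entry_gcd_scale g_def by metis
  then have "entry_gcd (upper a b d) = 1" using g by simp
  then show thesis using that[of a b d] a b d X by (simp add: primitive_hermite_def vertex_def Md rd)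
qed
section \<open>Hyper-distance and order on the big picture\<close>

lemma hyper_dist_vertex:
  assumes "primitive_hermite a b d" "primitive_hermite a' b' d'"
  shows "hyper_dist (vertex a b d) (vertex a' b' d') =
    of_int (a * d * (a' * d')) / (of_int (entry_gcd (upper a b d ** adj2 (upper a' b' d'))))\<^sup>2"
proof -
  have h: "0 < a" "0 < d" "0 < a'" "0 < d'" using assms by (simp_all add: primitive_hermite_def)
  have "hyper_dist (vertex a b d) (vertex a' b' d') =
      hyper_dist_mat (alpha (of_int a / of_int d) (of_int b / of_int d)) (alpha (of_int a' / of_int d') (of_int b' / of_int d'))"
    unfolding vertex_def using h by (subst hyper_dist.abs_eq) (simp_all add: picture_rel_def)
  also have "\<dots> = of_int (det (upper a b d) * det (upper a' b' d')) /
      (of_int (entry_gcd (upper a b d ** adj2 (upper a' b' d'))))\<^sup>2"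
    unfolding alpha_eq_upper[OF h(2)] alpha_eq_upper[OF h(4)]
    using h by (intro hyper_dist_scaled_mat) simp_all
  finally show ?thesis by (simp only: det_upper)
qed

text \<open>
  Multiplying \<open>A adj(B)\<close> by \<open>adj(A)\<close> on the left gives \<open>(det A) adj(B)\<close>, whose content is \<open>\<bar>det A\<bar>\<close>
  because the entries of \<open>B\<close> are coprime; multiplying by \<open>B\<close> on the right gives \<open>(det B) A\<close>.
\<close>

lemma primitive_entry_gcd_dvd_det:
  assumes "entry_gcd A = 1" "entry_gcd B = 1"
  shows "entry_gcd (A ** adj2 B) dvd det A" "entry_gcd (A ** adj2 B) dvd det B"
proof -
  let ?g = "entry_gcd (A ** adj2 B)"
  have dvd: "?g dvd x" if "?g dvd entry_gcd (map_matrix ((*) x) C)" "entry_gcd C = 1" for x C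
    using that by (simp add: entry_gcd_scale)
  have "entry_gcd (adj2 B) dvd entry_gcd B"
    using entry_gcd_dvd[of "adj2 B" 1 1] entry_gcd_dvd[of "adj2 B" 1 2]
      entry_gcd_dvd[of "adj2 B" 2 1] entry_gcd_dvd[of "adj2 B" 2 2]
    by (simp add: dvd_entry_gcd_iff forall_2) (simp add: adj2_def)
  then have adjB: "entry_gcd (adj2 B) = 1"
    using assms(2) entry_gcd_nonneg[of "adj2 B"] by simp
  have e1: "adj2 A ** (A ** adj2 B) = map_matrix ((*) (det A)) (adj2 B)"
    by (rule mat2_eqI; simp add: mat2_mult_nth adj2_def det_2 algebra_simps)
  have "?g dvd entry_gcd (map_matrix ((*) (det A)) (adj2 B))"
    using entry_gcd_dvd_mult(2)[of "A ** adj2 B" "adj2 A"] unfolding e1 .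
  then show "?g dvd det A" using adjB by (rule dvd)
  have e2: "(A ** adj2 B) ** B = map_matrix ((*) (det B)) A"
    by (rule mat2_eqI; simp add: mat2_mult_nth adj2_def det_2 algebra_simps)
  have "?g dvd entry_gcd (map_matrix ((*) (det B)) A)"
    using entry_gcd_dvd_mult(1)[of "A ** adj2 B" B] unfolding e2 .
  then show "?g dvd det B" using assms(1) by (rule dvd)
qed

lemma ext_hyper_dist_beta: "of_nat (ext_hyper_dist (beta X) (beta Y)) = hyper_dist X Y"
proof -
  obtain a b d where X: "primitive_hermite a b d" "X = vertex a b d" by (rule vertex_cases)
  obtain a' b' d' where Y: "primitive_hermite a' b' d'" "Y = vertex a' b' d'" by (rule vertex_cases)
  let ?A = "upper a b d" and ?B = "upper a' b' d'"
  let ?g = "entry_gcd (?A ** adj2 ?B)"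
  have h: "0 < a" "0 < d" "0 < a'" "0 < d'" "entry_gcd ?A = 1" "entry_gcd ?B = 1"
    using X(1) Y(1) by (simp_all add: primitive_hermite_def)
  have x: "beta X = abs_ns_class ?A" "cdet (beta X) = nat (a * d)"
    using X h beta_vertex by (simp_all add: cdet_abs)
  have y: "beta Y = abs_ns_class ?B" "cdet (beta Y) = nat (a' * d')"
    using Y h beta_vertex by (simp_all add: cdet_abs)
  have "?g dvd gcd (det ?A) (det ?B)"
    using primitive_entry_gcd_dvd_det[OF h(5,6)] by (rule gcd_greatest)
  then have g: "int (cdet (inf (beta X) (beta Y))) = ?g"
    unfolding x(1) y(1) using h by (simp add: cdet_inf gcd_proj2_if_dvd entry_gcd_nonneg)
  have "int (ext_hyper_dist (beta X) (beta Y)) * ?g\<^sup>2 = a * d * (a' * d')"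
    using arg_cong[OF ext_hyper_dist_mult[of "beta X" "beta Y"], of int] h by (simp add: g x(2) y(2))
  then have "(of_int (int (ext_hyper_dist (beta X) (beta Y)) * ?g\<^sup>2) :: rat) = of_int (a * d * (a' * d'))"
    by (simp only:)
  then have eq: "of_nat (ext_hyper_dist (beta X) (beta Y)) * (of_int ?g)\<^sup>2 = (of_int (a * d * (a' * d')) :: rat)"
    by (simp only: of_int_mult of_int_power of_int_of_nat_eq)
  have "?g \<noteq> 0" using g cdet_pos[of "inf (beta X) (beta Y)"] by linarith
  then have nz: "(of_int ?g :: rat)\<^sup>2 \<noteq> 0" by simp
  show ?thesis
    using eq unfolding X(2) Y(2) hyper_dist_vertex[OF X(1) Y(1)] nonzero_eq_divide_eq[OF nz] .
qed

lemma beta_picture_one: "beta picture_one \<le> a" "cdet (beta picture_one) = 1"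
proof -
  have p: "primitive_hermite 1 0 1" by (simp add: primitive_hermite_def entry_gcd_def)
  have "picture_one = vertex 1 0 1" by (simp add: picture_one_def vertex_def)
  then have b: "beta picture_one = abs_ns_class (upper 1 0 1)" using beta_vertex[OF p] by simp
  then show "cdet (beta picture_one) = 1" by (simp add: cdet_abs)
  obtain A where A: "det A \<noteq> 0" "a = abs_ns_class A" by (rule abs_ns_class_cases)
  have "A = A ** upper 1 0 1" by (rule mat2_eqI; simp add: mat2_mult_nth)
  then show "beta picture_one \<le> a" using A unfolding b by (auto simp: less_eq_abs mat2_le_def)
qed

lemma hyper_dist_one: "hyper_dist picture_one X = of_nat (cdet (beta X))"
  using ext_hyper_dist_mult[of "beta picture_one" "beta X"]
  by (simp add: beta_picture_one inf_absorb1 flip: ext_hyper_dist_beta)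

text \<open>The right-hand side forces \<open>det (a \<and> b) = det a\<close>, and a class below \<open>a\<close> of equal determinant is \<open>a\<close>.\<close>

lemma le_iff_ext_hyper_dist:
  "a \<le> b \<longleftrightarrow> cdet b = ext_hyper_dist a b * cdet a"
proof
  assume "a \<le> b"
  then have "inf a b = a" by (rule inf_absorb1)
  then show "cdet b = ext_hyper_dist a b * cdet a"
    using ext_hyper_dist_mult[of a b] cdet_pos[of a] by (simp add: power2_eq_square)
next
  let ?f = "cdet (inf a b)"
  assume b: "cdet b = ext_hyper_dist a b * cdet a"
  have "ext_hyper_dist a b * ?f\<^sup>2 = ext_hyper_dist a b * (cdet a)\<^sup>2"
    using ext_hyper_dist_mult[of a b] by (simp add: b power2_eq_square mult.left_commute)
  then have "?f = cdet a" using ext_hyper_dist_pos[of a b] by simp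
  then have "inf a b = a" by (intro le_cdet_eq) simp_all
  then show "a \<le> b" by (simp add: inf.absorb_iff1)
qed

lemma beta_le_iff:
  "beta X \<le> beta Y \<longleftrightarrow> hyper_dist picture_one Y = hyper_dist X Y * hyper_dist picture_one X"
proof -
  have "beta X \<le> beta Y \<longleftrightarrow>
      (of_nat (cdet (beta Y)) :: rat) = of_nat (ext_hyper_dist (beta X) (beta Y) * cdet (beta X))"
    unfolding le_iff_ext_hyper_dist of_nat_eq_iff ..
  then show ?thesis by (simp add: hyper_dist_one ext_hyper_dist_beta)
qed

section \<open>Scalar multiples of primitive classes\<close>

lemma class_scale_beta_vertex:
  assumes "primitive_hermite a b d" "0 < n"
  shows "class_scale n (beta (vertex a b d)) = abs_ns_class (map_matrix ((*) (int n)) (upper a b d))"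
    and "det (map_matrix ((*) (int n)) (upper a b d)) \<noteq> 0"
    and "entry_gcd (map_matrix ((*) (int n)) (upper a b d)) = int n"
  using assms by (simp_all add: beta_vertex class_scale_abs primitive_hermite_def det_scale entry_gcd_scale)

lemma class_scale_beta_surj: "\<exists>n X. 0 < n \<and> a = class_scale n (beta X)"
proof -
  obtain A where A: "det A \<noteq> 0" "a = abs_ns_class A" by (rule abs_ns_class_cases)
  obtain n A' where A': "0 < n" "A = map_matrix ((*) (int n)) A'" "entry_gcd A' = 1" "det A' \<noteq> 0"
    using A(1) by (rule content_decomposition)
  obtain x y z where h: "0 < x" "0 < z" "0 \<le> y" "y < z" "gl2_equiv A' (upper x y z)"
    using A'(4) by (rule hermite_form)
  have "abs_ns_class A' = abs_ns_class (upper x y z)" using h A'(4) by (simp add: abs_ns_class_eq_iff)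
  moreover have "primitive_hermite x y z"
    using h A'(3) entry_gcd_gl2_equiv by (simp add: primitive_hermite_def)
  ultimately have "class_scale n (beta (vertex x y z)) = class_scale n (abs_ns_class A')"
    by (simp add: beta_vertex)
  also have "\<dots> = a" using A A' by (simp add: class_scale_abs)
  finally show ?thesis using A'(1) by metis
qed

lemma class_scale_beta_inj:
  assumes "0 < n" "0 < m" "class_scale n (beta X) = class_scale m (beta Y)"
  shows "n = m \<and> X = Y"
proof -
  obtain a b d where X: "primitive_hermite a b d" "X = vertex a b d" by (rule vertex_cases)
  obtain a' b' d' where Y: "primitive_hermite a' b' d'" "Y = vertex a' b' d'" by (rule vertex_cases)
  let ?A = "upper a b d" and ?B = "upper a' b' d'"
  note x = class_scale_beta_vertex[OF X(1) assms(1)] and y = class_scale_beta_vertex[OF Y(1) assms(2)]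
  have e: "gl2_equiv (map_matrix ((*) (int n)) ?A) (map_matrix ((*) (int m)) ?B)"
    using assms(3) x y by (simp add: X(2) Y(2) abs_ns_class_eq_iff)
  then have nm: "n = m" using entry_gcd_gl2_equiv x(3) y(3) by fastforce
  obtain U where U: "invertible U" "map_matrix ((*) (int n)) ?B = U ** map_matrix ((*) (int n)) ?A"
    using e nm by (auto simp: gl2_equiv_def)
  have "int n * ?B $ i $ j = int n * (U ** ?A) $ i $ j" for i j
    using arg_cong[OF U(2), of "\<lambda>M. M $ i $ j"] by (simp add: mat2_mult_nth algebra_simps)
  then have "?B = U ** ?A" using assms(1) by (simp add: vec_eq_iff)
  moreover have "det ?A \<noteq> 0" "det ?B \<noteq> 0" using X(1) Y(1) by (simp_all add: primitive_hermite_def)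
  ultimately have "gl2_equiv ?A ?B" using U(1) unfolding gl2_equiv_def by blast
  then have "a = a' \<and> b = b' \<and> d = d'"
    using X(1) Y(1) by (intro hermite_form_unique) (simp_all add: primitive_hermite_def)
  then show ?thesis using nm X(2) Y(2) by simp
qed

theorem proposition16:
  shows "(\<forall>a b :: ns_class. is_weighted_dist a b (ln (real (ext_hyper_dist a b)))) \<and>
    (\<forall>X Y :: picture. of_nat (ext_hyper_dist (beta X) (beta Y)) = hyper_dist X Y) \<and>
    (\<forall>X Y :: picture. beta X \<le> beta Y \<longleftrightarrow>
       hyper_dist picture_one Y = hyper_dist X Y * hyper_dist picture_one X) \<and>
    (\<forall>a :: ns_class. \<exists>!nX :: nat \<times> picture.
       0 < fst nX \<and> a = class_scale (fst nX) (beta (snd nX)))"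
proof (intro conjI allI)
  fix a :: ns_class
  show "\<exists>!nX :: nat \<times> picture. 0 < fst nX \<and> a = class_scale (fst nX) (beta (snd nX))"
  proof (rule ex_ex1I)
    show "\<exists>nX :: nat \<times> picture. 0 < fst nX \<and> a = class_scale (fst nX) (beta (snd nX))"
      using class_scale_beta_surj[of a] by auto
    show "nX = mY" if "0 < fst nX \<and> a = class_scale (fst nX) (beta (snd nX))"
      "0 < fst mY \<and> a = class_scale (fst mY) (beta (snd mY))" for nX mY :: "nat \<times> picture"
      using that class_scale_beta_inj by (metis prod_eqI)
  qed
qed (rule is_weighted_dist_ext_hyper_dist ext_hyper_dist_beta beta_le_iff)+

end
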